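(* There exist infinitely many (explicit) dimensions $n\ge 2$ and infinitely many closed Riemannian targets $(\mathcal N,h)$, occurring in pairs $(n,(\mathcal N,h))$, such that for each of these pairs there exists a non-trivial (i.e. non-constant), $C^{1,\alpha}$-regular (for some $\alpha\in(0,1)$), null-homotopic, $n$-harmonic map $u:(S^n,g_{round})\to(\mathcal N,h)$.
   Context: For a map $u:(S^n,g_{round})\to(\mathcal N,h)$ set $D_n(u)=\frac1n\int_{S^n}|du|^n\,d\mu$. A ($C^{1,\alpha}$) map is $n$-harmonic if it is a critical point of $D_n$ with respect to outer variations; equivalently, after isometrically embedding $(\mathcal N,h)\subset\mathbb R^N$ with second fundamental form $A$, $u$ is a weak solution of $-\mathrm{div}(|\nabla u|^{n-2}\nabla u)=|\nabla u|^{n-2}A_u(\nabla u,\nabla u)$. Null-homotopic means homotopic to a constant map. $g_{round}$ is the standard round metric. *)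

theory Defs
  imports "HOL-Analysis.Analysis"
begin

section \<open>Euclidean spaces of varying dimension\<close>

text \<open>
  The dimensions of the spheres and of the targets are quantified inside the statement, so they
  cannot be types. All Euclidean spaces live inside the inner product space of finitely supported
  real sequences; the space of dimension \<open>k\<close> is the subspace \<open>eucl k\<close> of sequences supported
  in the indices below \<open>k\<close>.
\<close>

typedef fseq = "{f :: nat \<Rightarrow> real. finite {i. f i \<noteq> 0}}"
  morphisms coord Fseq
  by (rule exI[of _ "\<lambda>_. 0"]) simp

setup_lifting type_definition_fseq

lemma finite_coord: "finite {i. coord x i \<noteq> 0}"
  using coord[of x] by simp

lemma fseq_eqI: "(\<And>i. coord x i = coord y i) \<Longrightarrow> x = y"
  by (simp add: coord_inject[symmetric] fun_eq_iff)

instantiation fseq :: real_vector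
begin

lift_definition zero_fseq :: fseq is "\<lambda>_. 0" by simp

lift_definition plus_fseq :: "fseq \<Rightarrow> fseq \<Rightarrow> fseq" is "\<lambda>f g i. f i + g i"
  subgoal for f g by (rule finite_subset[of _ "{i. f i \<noteq> 0} \<union> {i. g i \<noteq> 0}"]) auto
  done

lift_definition uminus_fseq :: "fseq \<Rightarrow> fseq" is "\<lambda>f i. - f i" by simp

lift_definition minus_fseq :: "fseq \<Rightarrow> fseq \<Rightarrow> fseq" is "\<lambda>f g i. f i - g i"
  subgoal for f g by (rule finite_subset[of _ "{i. f i \<noteq> 0} \<union> {i. g i \<noteq> 0}"]) auto
  done

lift_definition scaleR_fseq :: "real \<Rightarrow> fseq \<Rightarrow> fseq" is "\<lambda>c f i. c * f i"
  by (rule finite_subset[rotated]) auto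

instance
  by standard (transfer; simp add: algebra_simps)+

end

instantiation fseq :: real_inner
begin

definition inner_fseq :: "fseq \<Rightarrow> fseq \<Rightarrow> real"
  where "inner_fseq x y = (\<Sum>i | coord x i \<noteq> 0. coord x i * coord y i)"

definition norm_fseq :: "fseq \<Rightarrow> real"
  where "norm_fseq x = sqrt (inner x x)"

definition sgn_fseq :: "fseq \<Rightarrow> fseq"
  where "sgn_fseq x = x /\<^sub>R norm x"

definition dist_fseq :: "fseq \<Rightarrow> fseq \<Rightarrow> real"
  where "dist_fseq x y = norm (x - y)"

definition uniformity_fseq :: "(fseq \<times> fseq) filter"
  where "uniformity_fseq = (INF e\<in>{0<..}. principal {(x, y). dist (x::fseq) y < e})"

definition open_fseq :: "fseq set \<Rightarrow> bool"
  where "open_fseq U \<longleftrightarrow> (\<forall>x\<in>U. \<forall>\<^sub>F (x', y) in uniformity. x' = x \<longrightarrow> y \<in> U)"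

lemma inner_fseq_superset:
  assumes "finite S" "{i. coord x i \<noteq> 0} \<inter> {i. coord y i \<noteq> 0} \<subseteq> S"
  shows "inner x y = (\<Sum>i\<in>S. coord x i * coord y i)"
proof -
  have "inner x y = (\<Sum>i\<in>{i. coord x i \<noteq> 0} \<inter> {i. coord y i \<noteq> 0}. coord x i * coord y i)"
    unfolding inner_fseq_def by (rule sum.mono_neutral_right) (auto simp: finite_coord)
  also have "\<dots> = (\<Sum>i\<in>S. coord x i * coord y i)"
    using assms by (intro sum.mono_neutral_left) auto
  finally show ?thesis .
qed

instance
proof
  fix x y z :: fseq and r :: real
  let ?S = "{i. coord x i \<noteq> 0} \<union> {i. coord y i \<noteq> 0}"
  have fin: "finite ?S" by (simp add: finite_coord)
  show "inner x y = inner y x"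
    by (simp add: inner_fseq_superset[OF fin] inner_fseq_superset[OF fin, of y x] subset_iff
        mult.commute)
  have 1: "inner (x + y) z = (\<Sum>i\<in>?S. coord (x + y) i * coord z i)"
    by (rule inner_fseq_superset[OF fin]) (auto simp: plus_fseq.rep_eq)
  have 2: "inner x z = (\<Sum>i\<in>?S. coord x i * coord z i)"
    by (rule inner_fseq_superset[OF fin]) auto
  have 3: "inner y z = (\<Sum>i\<in>?S. coord y i * coord z i)"
    by (rule inner_fseq_superset[OF fin]) auto
  show "inner (x + y) z = inner x z + inner y z"
    unfolding 1 2 3 by (simp add: plus_fseq.rep_eq algebra_simps sum.distrib)
  have "inner (r *\<^sub>R x) y = (\<Sum>i\<in>?S. coord (r *\<^sub>R x) i * coord y i)"
    by (rule inner_fseq_superset[OF fin]) (auto simp: scaleR_fseq.rep_eq)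
  also have "\<dots> = r * (\<Sum>i\<in>?S. coord x i * coord y i)"
    by (simp add: scaleR_fseq.rep_eq sum_distrib_left mult.assoc)
  also have "(\<Sum>i\<in>?S. coord x i * coord y i) = inner x y"
    by (rule inner_fseq_superset[OF fin, symmetric]) auto
  finally show "inner (r *\<^sub>R x) y = r * inner x y" .
  show "0 \<le> inner x x"
    by (simp add: inner_fseq_def sum_nonneg)
  show "inner x x = 0 \<longleftrightarrow> x = 0"
  proof
    assume "inner x x = 0"
    then have "\<forall>i\<in>{i. coord x i \<noteq> 0}. coord x i * coord x i = 0"
      unfolding inner_fseq_def
      by (subst (asm) sum_nonneg_eq_0_iff) (auto simp: finite_coord)
    then show "x = 0"
      by (intro fseq_eqI) (auto simp: zero_fseq.rep_eq)
  qed (simp add: inner_fseq_def zero_fseq.rep_eq)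
qed (simp_all add: norm_fseq_def sgn_fseq_def dist_fseq_def uniformity_fseq_def open_fseq_def)

end

definition eucl :: "nat \<Rightarrow> fseq set"
  where "eucl k = {x. \<forall>i\<ge>k. coord x i = 0}"

lift_definition unit_vec :: "nat \<Rightarrow> fseq" is "\<lambda>i j. if j = i then 1 else 0"
  by simp

definition lebesgue_eucl :: "nat \<Rightarrow> fseq measure"
  where "lebesgue_eucl k = distr (\<Pi>\<^sub>M i\<in>{..<k}. lborel) borel (\<lambda>x. \<Sum>i<k. x i *\<^sub>R unit_vec i)"


section \<open>The round sphere\<close>

definition rsphere :: "nat \<Rightarrow> fseq set"
  where "rsphere n = sphere 0 1 \<inter> eucl (Suc n)"

text \<open>
  The Riemannian measure of the round metric, as the cone measure: a set \<open>A\<close> in the sphere has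
  measure \<open>n + 1\<close> times the Lebesgue measure of the cone of all \<open>t *\<^sub>R a\<close> with \<open>0 < t \<le> 1\<close> and
  \<open>a \<in> A\<close>. Here \<open>sgn x = x /\<^sub>R norm x\<close>.
\<close>

definition sphere_measure :: "nat \<Rightarrow> fseq measure"
  where "sphere_measure n =
    scale_measure (of_nat (Suc n))
      (distr (restrict_space (lebesgue_eucl (Suc n)) (cball 0 1 \<inter> eucl (Suc n) - {0}))
        (restrict_space borel (rsphere n)) sgn)"

text \<open>
  Differentiability of a map on the sphere is Frechet differentiability within the sphere. The
  derivative is then determined on tangent vectors only, so the argument is first projected
  orthogonally to the tangent space at \<open>x\<close>; this extends the differential by zero on the normal line.
\<close>

definition sdiff :: "nat \<Rightarrow> (fseq \<Rightarrow> fseq) \<Rightarrow> fseq \<Rightarrow> fseq \<Rightarrow> fseq"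
  where "sdiff n u x v = frechet_derivative u (at x within rsphere n) (v - (v \<bullet> x) *\<^sub>R x)"

definition C1_holder_on_sphere :: "nat \<Rightarrow> real \<Rightarrow> (fseq \<Rightarrow> fseq) \<Rightarrow> bool"
  where "C1_holder_on_sphere n \<alpha> u \<longleftrightarrow>
    (\<forall>x\<in>rsphere n. u differentiable (at x within rsphere n)) \<and>
    (\<exists>C. \<forall>x\<in>rsphere n. \<forall>y\<in>rsphere n. \<forall>v\<in>eucl (Suc n).
      norm (sdiff n u x v - sdiff n u y v) \<le> C * dist x y powr \<alpha> * norm v)"


section \<open>Closed Riemannian manifolds\<close>

text \<open>
  For \<open>U\<close> relatively open in \<open>eucl m\<close>: \<open>f\<close> is of class \<open>C\<^sup>k\<close> on \<open>U\<close>.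
\<close>

primrec Ck_on :: "nat \<Rightarrow> nat \<Rightarrow> fseq set \<Rightarrow> (fseq \<Rightarrow> 'b::real_normed_vector) \<Rightarrow> bool"
  where
    "Ck_on 0 m U f \<longleftrightarrow> continuous_on U f"
  | "Ck_on (Suc k) m U f \<longleftrightarrow>
      (\<forall>x\<in>U. f differentiable (at x within U)) \<and>
      (\<forall>i<m. Ck_on k m U (\<lambda>x. frechet_derivative f (at x within U) (unit_vec i)))"

definition smooth_on :: "nat \<Rightarrow> fseq set \<Rightarrow> (fseq \<Rightarrow> 'b::real_normed_vector) \<Rightarrow> bool"
  where "smooth_on m U f \<longleftrightarrow> (\<forall>k. Ck_on k m U f)"

definition local_param :: "nat \<Rightarrow> fseq set \<Rightarrow> fseq set \<Rightarrow> (fseq \<Rightarrow> fseq) \<Rightarrow> bool"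
  where "local_param m M U \<phi> \<longleftrightarrow>
    openin (top_of_set (eucl m)) U \<and> openin (top_of_set M) (\<phi> ` U) \<and>
    smooth_on m U \<phi> \<and>
    (\<forall>y\<in>U. inj_on (frechet_derivative \<phi> (at y within U)) (eucl m)) \<and>
    (\<exists>\<psi>. homeomorphism U (\<phi> ` U) \<phi> \<psi>)"

definition submanifold :: "nat \<Rightarrow> fseq set \<Rightarrow> bool"
  where "submanifold m M \<longleftrightarrow>
    (\<exists>K. M \<subseteq> eucl K) \<and> (\<forall>p\<in>M. \<exists>U \<phi>. local_param m M U \<phi> \<and> p \<in> \<phi> ` U)"

definition tangent_space :: "fseq set \<Rightarrow> fseq \<Rightarrow> fseq set"
  where "tangent_space M p =
    {v. \<exists>\<gamma>. (\<forall>t. \<gamma> t \<in> M) \<and> \<gamma> 0 = p \<and> (\<gamma> has_vector_derivative v) (at 0)}"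

type_synonym metric_tensor = "fseq \<Rightarrow> fseq \<Rightarrow> fseq \<Rightarrow> real"

text \<open>
  Only the values of \<open>h p\<close> on tangent vectors at points \<open>p\<close> of the manifold are meaningful; the
  metric need not be induced by the ambient inner product.
\<close>

definition riemannian_metric :: "fseq set \<Rightarrow> metric_tensor \<Rightarrow> bool"
  where "riemannian_metric M h \<longleftrightarrow>
    (\<forall>p\<in>M. \<forall>v\<in>tangent_space M p. \<forall>w\<in>tangent_space M p.
      h p v w = h p w v \<and> (v \<noteq> 0 \<longrightarrow> h p v v > 0) \<and>
      (\<forall>z\<in>tangent_space M p. \<forall>a b. h p (a *\<^sub>R v + b *\<^sub>R w) z = a * h p v z + b * h p w z)) \<and>
    (\<forall>m U \<phi>. local_param m M U \<phi> \<longrightarrow>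
      (\<forall>i<m. \<forall>j<m. smooth_on m U (\<lambda>y.
        h (\<phi> y) (frechet_derivative \<phi> (at y within U) (unit_vec i))
                (frechet_derivative \<phi> (at y within U) (unit_vec j)))))"

definition closed_riemannian :: "fseq set \<times> metric_tensor \<Rightarrow> bool"
  where "closed_riemannian N \<longleftrightarrow>
    (\<exists>m. submanifold m (fst N)) \<and> compact (fst N) \<and> connected (fst N) \<and> fst N \<noteq> {} \<and>
    riemannian_metric (fst N) (snd N)"

definition smooth_map :: "fseq set \<Rightarrow> (fseq \<Rightarrow> fseq) \<Rightarrow> bool"
  where "smooth_map M f \<longleftrightarrow> (\<forall>m U \<phi>. local_param m M U \<phi> \<longrightarrow> smooth_on m U (f \<circ> \<phi>))"

definition isometric :: "fseq set \<times> metric_tensor \<Rightarrow> fseq set \<times> metric_tensor \<Rightarrow> bool"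
  where "isometric N N' \<longleftrightarrow>
    (\<exists>f g. homeomorphism (fst N) (fst N') f g \<and> smooth_map (fst N) f \<and> smooth_map (fst N') g \<and>
      (\<forall>p\<in>fst N. \<forall>v\<in>tangent_space (fst N) p. \<forall>w\<in>tangent_space (fst N) p.
        snd N' (f p) (frechet_derivative f (at p within fst N) v)
                     (frechet_derivative f (at p within fst N) w) = snd N p v w))"


section \<open>The conformal energy and its critical points\<close>

text \<open>
  The squared norm of \<open>du\<close> at \<open>x\<close> is the trace of the pulled back metric over the tangent space
  of the sphere. Since \<open>sdiff n u x\<close> vanishes on the normal vector \<open>x\<close>, this equals the trace over
  the ambient Euclidean space.
\<close>

definition sq_norm_diff :: "nat \<Rightarrow> metric_tensor \<Rightarrow> (fseq \<Rightarrow> fseq) \<Rightarrow> fseq \<Rightarrow> real"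
  where "sq_norm_diff n h u x =
    (\<Sum>i\<le>n. h (u x) (sdiff n u x (unit_vec i)) (sdiff n u x (unit_vec i)))"

definition n_energy :: "nat \<Rightarrow> metric_tensor \<Rightarrow> (fseq \<Rightarrow> fseq) \<Rightarrow> real"
  where "n_energy n h u = 1 / real n * (\<integral>x. sqrt (sq_norm_diff n h u x) ^ n \<partial>sphere_measure n)"

text \<open>
  An outer variation of \<open>u\<close> is a family of maps \<open>F t\<close> of the sphere into \<open>M\<close> with \<open>F 0 = u\<close> that is
  continuously differentiable in \<open>t\<close> with respect to the \<open>C\<^sup>1\<close> topology: \<open>t\<close>-derivatives of \<open>F\<close> and of its
  differential exist and are jointly continuous. (As \<open>u\<close> is only \<open>C\<^sup>1\<close>, smoothness in \<open>x\<close> cannot be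
  required.) This includes the variations obtained by projecting \<open>u + t *\<^sub>R \<phi>\<close> to the target.
\<close>

definition C1_family :: "nat \<Rightarrow> real set \<Rightarrow> (real \<Rightarrow> fseq \<Rightarrow> fseq) \<Rightarrow> bool"
  where "C1_family n I F \<longleftrightarrow>
    (\<forall>t\<in>I. \<forall>x\<in>rsphere n. F t differentiable (at x within rsphere n)) \<and>
    continuous_on (I \<times> rsphere n) (\<lambda>(t, x). F t x) \<and>
    (\<forall>v\<in>eucl (Suc n). continuous_on (I \<times> rsphere n) (\<lambda>(t, x). sdiff n (F t) x v))"

definition outer_variation ::
    "nat \<Rightarrow> fseq set \<Rightarrow> (fseq \<Rightarrow> fseq) \<Rightarrow> (real \<Rightarrow> fseq \<Rightarrow> fseq) \<Rightarrow> bool"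
  where "outer_variation n M u F \<longleftrightarrow>
    (\<forall>x\<in>rsphere n. F 0 x = u x) \<and>
    (\<exists>\<delta>>0. \<exists>F'.
      (\<forall>t\<in>{-\<delta><..<\<delta>}. \<forall>x\<in>rsphere n. F t x \<in> M) \<and>
      C1_family n {-\<delta><..<\<delta>} F \<and> C1_family n {-\<delta><..<\<delta>} F' \<and>
      (\<forall>t\<in>{-\<delta><..<\<delta>}. \<forall>x\<in>rsphere n.
        ((\<lambda>s. F s x) has_vector_derivative F' t x) (at t) \<and>
        (\<forall>v\<in>eucl (Suc n).
          ((\<lambda>s. sdiff n (F s) x v) has_vector_derivative sdiff n (F' t) x v) (at t))))"

definition n_harmonic :: "nat \<Rightarrow> fseq set \<times> metric_tensor \<Rightarrow> (fseq \<Rightarrow> fseq) \<Rightarrow> bool"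
  where "n_harmonic n N u \<longleftrightarrow>
    (\<forall>F. outer_variation n (fst N) u F \<longrightarrow>
      ((\<lambda>t. n_energy n (snd N) (F t)) has_real_derivative 0) (at 0))"

definition null_homotopic :: "nat \<Rightarrow> fseq set \<Rightarrow> (fseq \<Rightarrow> fseq) \<Rightarrow> bool"
  where "null_homotopic n M u \<longleftrightarrow>
    (\<exists>c. homotopic_with_canon (\<lambda>_. True) (rsphere n) M u (\<lambda>_. c))"

end

theory Submission
  imports Defs
begin

text \<open>All spheres lie in one infinite-dimensional space, where they and the subsets of
  \<open>eucl m\<close> have empty interior. A derivative within such a set is not unique, and
  \<open>frechet_derivative\<close> is only some choice of one. What is determined is its value on
  velocities of curves inside the set; hence differentials are always evaluated along great circles,
  rotation orbits or straight segments. The measure is a cone measure, so its rotation invariance is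
  that of Lebesgue measure. A rotation by an angle with cosine different from -1 is a product of
  three shears, and a shear is handled by Fubini and translation invariance of the line. Such angles
  suffice because the invariance is only differentiated at angle 0. The targets also differ in
  dimension, but the length comparison is indifferent to that: it uses only a differentiable
  surjection between spheres that halves velocities.\<close>

text \<open>
  The equatorial inclusion of \<open>S\<^sup>n\<close> into \<open>S\<^sup>n\<^sup>+\<^sup>1\<close> is totally geodesic with \<open>|du|\<^sup>2\<close> constant, hence
  \<open>n\<close>-harmonic, and it contracts to a pole of \<open>S\<^sup>n\<^sup>+\<^sup>1\<close>. Its first variation in the direction of a
  field \<open>V\<close> along the equator is a multiple of the integral over \<open>S\<^sup>n\<close> of the divergence of \<open>V\<close>,
  which vanishes because the measure is invariant under rotations of coordinate planes. Even \<open>n\<close>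
  makes \<open>|du|\<^sup>n\<close> a polynomial in \<open>|du|\<^sup>2\<close>. The round metrics are scaled by powers of 4, so that an
  isometry between two of the targets, or its inverse, would halve the lengths of curves; this is
  impossible since antipodal points have distance \<open>2 > \<pi> / 2\<close> but great circle arcs joining any two
  points have length at most \<open>\<pi>\<close>.
\<close>

section \<open>Spheres in the sequence space\<close>

lemma coord_arith [simp]:
  "coord 0 i = 0" "coord (x + y) i = coord x i + coord y i"
  "coord (x - y) i = coord x i - coord y i" "coord (- x) i = - coord x i"
  "coord (c *\<^sub>R x) i = c * coord x i" "coord (unit_vec j) i = (if i = j then 1 else 0)"
  by (simp_all add: zero_fseq.rep_eq plus_fseq.rep_eq minus_fseq.rep_eq uminus_fseq.rep_eq
      scaleR_fseq.rep_eq unit_vec.rep_eq)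

lemma inner_unit_vec: "x \<bullet> unit_vec i = coord x i"
  by (subst inner_fseq_superset[of "{i}"]) auto

lemma bounded_linear_coord: "bounded_linear (\<lambda>x. coord x i)"
  using bounded_linear_inner_left[of "unit_vec i"] by (simp add: inner_unit_vec)

lemmas continuous_on_coord [continuous_intros] =
  bounded_linear.continuous_on[OF bounded_linear_coord]
lemmas has_vector_derivative_coord = bounded_linear.has_vector_derivative[OF bounded_linear_coord]
lemmas coord_sum = bounded_linear.linear[OF bounded_linear_coord, THEN linear_sum]

lemma subspace_eucl: "subspace (eucl k)"
  by (auto simp: subspace_def eucl_def)

lemmas eucl_closed_ops = subspace_add[OF subspace_eucl] subspace_diff[OF subspace_eucl]
  subspace_scale[OF subspace_eucl] subspace_0[OF subspace_eucl] subspace_sum[OF subspace_eucl]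

lemma unit_vec_in_eucl [simp]: "unit_vec i \<in> eucl k \<longleftrightarrow> i < k"
  by (auto simp: eucl_def split: if_splits)

lemma eucl_mono: "k \<le> l \<Longrightarrow> eucl k \<subseteq> eucl l"
  by (auto simp: eucl_def)

lemma closed_eucl: "closed (eucl k)"
proof -
  have "eucl k = (\<Inter>i\<in>{k..}. {x. coord x i = 0})"
    by (auto simp: eucl_def)
  moreover have "closed {x. coord x i = 0}" for i
    by (intro closed_Collect_eq continuous_intros)
  ultimately show ?thesis
    by (simp add: closed_INT)
qed

lemma eucl_expand: "x \<in> eucl k \<Longrightarrow> x = (\<Sum>i<k. coord x i *\<^sub>R unit_vec i)"
proof (rule fseq_eqI)
  fix j assume "x \<in> eucl k"
  then have "coord x j = (if j < k then coord x j else 0)"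
    by (simp add: eucl_def)
  also have "\<dots> = (\<Sum>i<k. if i = j then coord x j else 0)"
    by simp
  also have "\<dots> = coord (\<Sum>i<k. coord x i *\<^sub>R unit_vec i) j"
    unfolding coord_sum by (intro sum.cong) auto
  finally show "coord x j = coord (\<Sum>i<k. coord x i *\<^sub>R unit_vec i) j" .
qed

lemma inner_eucl:
  assumes "x \<in> eucl k"
  shows "x \<bullet> y = (\<Sum>i<k. coord x i * coord y i)"
  using assms by (intro inner_fseq_superset) (auto simp: eucl_def intro: leI)

lemma norm_unit_vec [simp]: "norm (unit_vec i) = 1"
  by (simp add: norm_eq_sqrt_inner inner_unit_vec)

lemma rsphere_iff: "x \<in> rsphere n \<longleftrightarrow> x \<bullet> x = 1 \<and> x \<in> eucl (Suc n)"
  by (auto simp: rsphere_def norm_eq_sqrt_inner)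

lemma rsphere_coord_sum: "x \<in> rsphere n \<Longrightarrow> (\<Sum>i\<le>n. coord x i * coord x i) = 1"
  using inner_eucl[of x "Suc n" x] by (simp add: rsphere_iff lessThan_Suc_atMost)

lemma rsphere_inner_self: "x \<in> rsphere n \<Longrightarrow> x \<bullet> x = 1"
  by (simp add: rsphere_iff)

lemma rsphere_norm: "x \<in> rsphere n \<Longrightarrow> norm x = 1"
  by (simp add: rsphere_def)

lemma unit_vec_in_rsphere: "i \<le> n \<Longrightarrow> unit_vec i \<in> rsphere n"
  by (simp add: rsphere_iff inner_unit_vec)

text \<open>Balls of the whole sequence space are not compact, so the dimension enters by induction:
  the unit ball of \<open>eucl (Suc k)\<close> lies in the image of \<open>K\<close> times an
  interval under a continuous map, where the compact \<open>K\<close> contains the unit ball of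
  \<open>eucl k\<close>. The sphere is then a closed subset of a compact set.\<close>

lemma compact_rsphere: "compact (rsphere n)"
proof -
  have "\<exists>K. compact K \<and> cball 0 1 \<inter> eucl k \<subseteq> K" for k
  proof (induction k)
    case 0
    have "cball 0 1 \<inter> eucl 0 \<subseteq> {0}"
      by (auto simp: eucl_def intro!: fseq_eqI)
    then show ?case
      by (metis compact_sing)
  next
    case (Suc k)
    then obtain K where K: "compact K" "cball 0 1 \<inter> eucl k \<subseteq> K"
      by blast
    define K' where "K' = (\<lambda>(x, t). x + t *\<^sub>R unit_vec k) ` (K \<times> {- 1..1::real})"
    have "compact K'"
      unfolding K'_def case_prod_beta
      by (intro compact_continuous_image compact_Times K compact_Icc continuous_intros)
    moreover have "cball 0 1 \<inter> eucl (Suc k) \<subseteq> K'"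
    proof
      fix x assume x: "x \<in> cball 0 1 \<inter> eucl (Suc k)"
      let ?y = "x - coord x k *\<^sub>R unit_vec k"
      have "coord x i = 0" if "i \<ge> k" "i \<noteq> k" for i
        using x that by (auto simp: eucl_def)
      then have y: "?y \<in> eucl k"
        by (auto simp: eucl_def)
      have xx: "x \<bullet> x \<le> 1"
        using x by (simp add: norm_eq_sqrt_inner)
      have "?y \<bullet> ?y = x \<bullet> x - (coord x k)\<^sup>2"
        by (simp add: inner_diff_left inner_diff_right inner_unit_vec inner_commute[of "unit_vec k"]
            power2_eq_square)
      then have "?y \<bullet> ?y \<le> 1"
        using xx by (smt (verit) zero_le_power2)
      then have "norm ?y \<le> 1"
        by (simp add: norm_eq_sqrt_inner)
      moreover have "\<bar>coord x k\<bar> \<le> 1"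
        using \<open>?y \<bullet> ?y = _\<close> xx inner_ge_zero[of ?y] by (simp add: abs_square_le_1[symmetric])
      ultimately show "x \<in> K'"
        using y K(2) unfolding K'_def
        by (intro image_eqI[of _ _ "(?y, coord x k)"]) (auto simp: abs_le_iff)
    qed
    ultimately show ?case
      by blast
  qed
  then obtain K where K: "compact K" "cball 0 1 \<inter> eucl (Suc n) \<subseteq> K"
    by blast
  then have "rsphere n = K \<inter> rsphere n"
    by (auto simp: rsphere_def)
  moreover have "closed (rsphere n)"
    unfolding rsphere_def sphere_def
    by (intro closed_Int closed_eucl closed_Collect_eq continuous_intros)
  ultimately show ?thesis
    using K(1) by (metis compact_Int_closed)
qed

text \<open>Chain rule for an arbitrary derivative \<open>D\<close> within \<open>S\<close>. As the
  velocity of the composed curve is unique, any two choices of \<open>D\<close> agree on velocities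
  of curves in \<open>S\<close>; this is the substitute for uniqueness of derivatives.\<close>

lemma has_vector_derivative_along_curve:
  assumes f: "(f has_derivative D) (at x within S)"
    and \<gamma>: "(\<gamma> has_vector_derivative v) (at t)" "\<gamma> t = x"
    and T: "open T" "t \<in> T" "\<And>s. s \<in> T \<Longrightarrow> \<gamma> s \<in> S"
  shows "((\<lambda>s. f (\<gamma> s)) has_vector_derivative D v) (at t)"
proof -
  have "(\<gamma> has_derivative (\<lambda>h. h *\<^sub>R v)) (at t within T)"
    using \<gamma>(1) by (simp only: has_vector_derivative_def at_within_open[OF T(2,1)])
  moreover have "(f has_derivative D) (at (\<gamma> t) within \<gamma> ` T)"
    using T(3) by (intro has_derivative_subset[OF f[folded \<gamma>(2)]]) auto
  ultimately have "(f \<circ> \<gamma> has_derivative D \<circ> (\<lambda>h. h *\<^sub>R v)) (at t within T)"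
    by (rule diff_chain_within)
  then show ?thesis
    using linear_scale[OF has_derivative_linear[OF f]]
    by (simp add: has_vector_derivative_def at_within_open[OF T(2,1)] o_def)
qed

lemma has_vector_derivative_along_global_curve:
  assumes "(f has_derivative D) (at (\<gamma> t) within S)"
    and "(\<gamma> has_vector_derivative v) (at t)" "\<And>s. \<gamma> s \<in> S"
  shows "((\<lambda>s. f (\<gamma> s)) has_vector_derivative D v) (at t)"
  using has_vector_derivative_along_curve[OF assms(1,2) refl, of UNIV] assms(3) by simp

section \<open>Great circles: parametrisation, speed, and arcs joining two points\<close>

definition great_circle :: "fseq \<Rightarrow> fseq \<Rightarrow> real \<Rightarrow> fseq"
  where "great_circle p w t = cos t *\<^sub>R p + sin t *\<^sub>R w"

lemma great_circle_in_rsphere: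
  assumes "p \<in> rsphere n" "w \<in> rsphere n" "p \<bullet> w = 0"
  shows "great_circle p w t \<in> rsphere n"
proof -
  have "w \<bullet> p = 0"
    using assms(3) by (simp add: inner_commute)
  then have "great_circle p w t \<bullet> great_circle p w t = (cos t)\<^sup>2 + (sin t)\<^sup>2"
    using assms by (simp add: great_circle_def inner_add_left inner_add_right rsphere_iff
        power2_eq_square)
  then show ?thesis
    using assms by (simp add: rsphere_iff great_circle_def eucl_closed_ops)
qed

lemma has_vector_derivative_great_circle:
  "(great_circle p w has_vector_derivative (cos t *\<^sub>R w - sin t *\<^sub>R p)) (at t)"
proof -
  have "(great_circle p w has_vector_derivative
      (cos t *\<^sub>R 0 + (- sin t) *\<^sub>R p) + (sin t *\<^sub>R 0 + cos t *\<^sub>R w)) (at t)"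
    unfolding great_circle_def[abs_def]
    by (intro has_vector_derivative_add has_vector_derivative_scaleR has_vector_derivative_const
        DERIV_cos DERIV_sin)
  then show ?thesis
    by simp
qed

lemma great_circle_0 [simp]: "great_circle p w 0 = p"
  by (simp add: great_circle_def)

lemma norm_great_circle_velocity:
  assumes "p \<in> rsphere n" "w \<in> rsphere n" "p \<bullet> w = 0"
  shows "norm (cos t *\<^sub>R w - sin t *\<^sub>R p) = 1"
proof -
  have "cos t *\<^sub>R w - sin t *\<^sub>R p = great_circle p w (t + pi / 2)"
    by (simp add: great_circle_def cos_add sin_add)
  then show ?thesis
    using rsphere_norm[OF great_circle_in_rsphere[OF assms]] by simp
qed

lemma ex_orthogonal_in_rsphere:
  assumes "p \<in> rsphere n" "n \<ge> 1"
  shows "\<exists>w\<in>rsphere n. p \<bullet> w = 0"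
proof (cases "coord p 0 = 0")
  case True
  then show ?thesis
    using assms by (intro bexI[of _ "unit_vec 0"]) (auto simp: inner_unit_vec unit_vec_in_rsphere)
next
  case False
  \<comment> \<open>A quarter turn of the first two coordinates of \<open>p\<close>, the others
    being dropped: orthogonal to \<open>p\<close>, and nonzero in this case.\<close>
  define v where "v = coord p 1 *\<^sub>R unit_vec 0 - coord p 0 *\<^sub>R unit_vec 1"
  have "coord v 1 \<noteq> 0"
    using False by (simp add: v_def)
  then have "v \<noteq> 0"
    by auto
  moreover have "v \<in> eucl (Suc n)" "p \<bullet> v = 0"
    using assms by (auto simp: v_def inner_diff_right inner_unit_vec intro!: eucl_closed_ops)
  ultimately show ?thesis
    by (intro bexI[of _ "sgn v"])
      (auto simp: rsphere_def sgn_div_norm norm_sgn eucl_closed_ops)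
qed

lemma ex_great_circle:
  assumes p: "p \<in> rsphere n" and q: "q \<in> rsphere n" and n: "n \<ge> 1"
  obtains w t where "w \<in> rsphere n" "p \<bullet> w = 0" "0 \<le> t" "t \<le> pi" "great_circle p w t = q"
proof -
  define c where "c = p \<bullet> q"
  define v where "v = q - c *\<^sub>R p"
  have vv: "v \<bullet> v = 1 - c\<^sup>2"
    using p q by (simp add: v_def c_def inner_diff_left inner_diff_right rsphere_iff
        inner_commute[of q p] power2_eq_square)
  then have "c\<^sup>2 \<le> 1"
    using inner_ge_zero[of v] by linarith
  then have c: "\<bar>c\<bar> \<le> 1"
    by (simp add: abs_square_le_1)
  have sin: "sin (arccos c) = norm v"
    using c vv by (simp add: sin_arccos_abs norm_eq_sqrt_inner)
  obtain w where w: "w \<in> rsphere n" "p \<bullet> w = 0" "norm v *\<^sub>R w = v"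
  proof (cases "v = 0")
    case True
    then show ?thesis
      using ex_orthogonal_in_rsphere[OF p n] that by auto
  next
    case False
    have "v \<in> eucl (Suc n)" "p \<bullet> v = 0"
      using p q by (auto simp: v_def c_def inner_diff_right rsphere_iff intro!: eucl_closed_ops)
    with False show ?thesis
      by (intro that[of "sgn v"]) (auto simp: rsphere_def sgn_div_norm norm_sgn eucl_closed_ops)
  qed
  have "great_circle p w (arccos c) = q"
    using c w(3) by (simp add: great_circle_def sin cos_arccos_abs v_def)
  with w c show ?thesis
    by (intro that[of w "arccos c"]) (auto simp: arccos_lbound arccos_ubound abs_le_iff)
qed

lemma connected_rsphere:
  assumes "n \<ge> 1"
  shows "connected (rsphere n)"
proof (rule path_connected_imp_connected, unfold path_connected_component, intro ballI)
  fix p q assume pq: "p \<in> rsphere n" "q \<in> rsphere n"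
  then obtain w t where w: "w \<in> rsphere n" "p \<bullet> w = 0" "great_circle p w t = q"
    using ex_great_circle assms by metis
  have "path (\<lambda>s. great_circle p w (s * t))"
    unfolding path_def great_circle_def by (intro continuous_intros)
  then show "path_component (rsphere n) p q"
    using w pq unfolding path_component_def
    by (intro exI[of _ "\<lambda>s. great_circle p w (s * t)"])
      (auto simp: path_image_def pathstart_def pathfinish_def great_circle_in_rsphere)
qed

section \<open>Differentials of maps on the sphere\<close>

lemma sdiff_has_vector_derivative:
  assumes "u differentiable (at (\<gamma> t) within rsphere n)"
    and "\<And>s. \<gamma> s \<in> rsphere n" "(\<gamma> has_vector_derivative v) (at t)"
  shows "((\<lambda>s. u (\<gamma> s)) has_vector_derivative sdiff n u (\<gamma> t) v) (at t)"
proof -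
  \<comment> \<open>Differentiating \<open>\<gamma> s \<bullet> \<gamma> s = 1\<close> shows that
    the velocity is tangent, so the projection built into \<open>sdiff\<close> leaves it
    unchanged.\<close>
  have "((\<lambda>s. \<gamma> s \<bullet> \<gamma> s) has_vector_derivative (\<gamma> t \<bullet> v + v \<bullet> \<gamma> t)) (at t)"
    by (rule bounded_bilinear.has_vector_derivative[OF bounded_bilinear_inner assms(3,3)])
  moreover have "(\<lambda>s. \<gamma> s \<bullet> \<gamma> s) = (\<lambda>s. 1)"
    using assms(2) by (simp add: rsphere_iff)
  ultimately have "\<gamma> t \<bullet> v + v \<bullet> \<gamma> t = 0"
    using vector_derivative_unique_at has_vector_derivative_const by metis
  then have "v - (v \<bullet> \<gamma> t) *\<^sub>R \<gamma> t = v"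
    by (auto simp: inner_commute)
  with has_vector_derivative_along_global_curve[OF
        assms(1)[unfolded frechet_derivative_works] assms(3,2)]
  show ?thesis
    by (simp only: sdiff_def)
qed

lemma sdiff_add:
  assumes "u differentiable (at x within rsphere n)"
  shows "sdiff n u x (v + w) = sdiff n u x v + sdiff n u x w"
proof -
  have "linear (frechet_derivative u (at x within rsphere n))"
    using assms frechet_derivative_works has_derivative_linear by blast
  then show ?thesis
    unfolding sdiff_def by (simp add: linear_add[symmetric] algebra_simps)
qed

lemma sdiff_scale:
  assumes "u differentiable (at x within rsphere n)"
  shows "sdiff n u x (c *\<^sub>R v) = c *\<^sub>R sdiff n u x v"
proof -
  have "linear (frechet_derivative u (at x within rsphere n))"
    using assms frechet_derivative_works has_derivative_linear by blast
  then show ?thesis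
    unfolding sdiff_def by (simp add: linear_scale[symmetric] algebra_simps)
qed

lemma linear_sdiff:
  "u differentiable (at x within rsphere n) \<Longrightarrow> linear (sdiff n u x)"
  by (simp add: linear_iff sdiff_add sdiff_scale)

lemma sdiff_normal:
  assumes "u differentiable (at x within rsphere n)" "x \<in> rsphere n"
  shows "sdiff n u x x = 0"
proof -
  have "linear (frechet_derivative u (at x within rsphere n))"
    using assms frechet_derivative_works has_derivative_linear by blast
  then show ?thesis
    using assms(2) by (simp add: sdiff_def rsphere_iff linear_0)
qed

text \<open>By linearity the sum is the differential applied to \<open>x\<close> itself, the normal
  vector, which the projection in \<open>sdiff\<close> kills. Both the divergence formula and the
  first variation drop their normal terms by this identity.\<close>

lemma sum_coord_sdiff:
  assumes "u differentiable (at x within rsphere n)" "x \<in> rsphere n"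
  shows "(\<Sum>i\<le>n. coord x i *\<^sub>R sdiff n u x (unit_vec i)) = 0"
proof -
  note lin = linear_sdiff[OF assms(1)]
  have "(\<Sum>i\<le>n. coord x i *\<^sub>R sdiff n u x (unit_vec i)) =
      sdiff n u x (\<Sum>i\<le>n. coord x i *\<^sub>R unit_vec i)"
    by (simp add: linear_sum[OF lin] linear_scale[OF lin])
  also have "(\<Sum>i\<le>n. coord x i *\<^sub>R unit_vec i) = x"
    using eucl_expand[of x "Suc n"] assms(2) by (simp add: rsphere_iff lessThan_Suc_atMost)
  finally show ?thesis
    by (simp only: sdiff_normal[OF assms])
qed

lemma continuous_on_rsphere:
  assumes "\<And>x. x \<in> rsphere n \<Longrightarrow> u differentiable (at x within rsphere n)"
  shows "continuous_on (rsphere n) u"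
  using assms differentiable_imp_continuous_within continuous_on_eq_continuous_within by blast

text \<open>Maps that agree on the sphere have the same set of derivatives within it, so the choice
  operator in \<open>frechet_derivative\<close> picks the same one, non-uniqueness notwithstanding.
  It is needed because \<open>F 0\<close> agrees with the inclusion on the sphere only.\<close>

lemma sdiff_cong_fun:
  assumes "\<And>x. x \<in> rsphere n \<Longrightarrow> u x = u' x" "x \<in> rsphere n"
  shows "sdiff n u x = sdiff n u' x"
proof -
  have "(u has_derivative D) (at x within rsphere n) \<longleftrightarrow>
      (u' has_derivative D) (at x within rsphere n)" for D
    using assms has_derivative_transform[of x "rsphere n" u' u D]
      has_derivative_transform[of x "rsphere n" u u' D] by auto
  then show ?thesis
    unfolding sdiff_def[abs_def] frechet_derivative_def by simp
qed

text \<open>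
  Differentials within the sphere are only determined on tangent vectors, each of which is the
  velocity of a great circle up to a factor.
\<close>

lemma sdiff_id:
  assumes x: "x \<in> rsphere n" and v: "v \<in> eucl (Suc n)"
  shows "sdiff n (\<lambda>x. x) x v = v - (v \<bullet> x) *\<^sub>R x"
proof (cases "v - (v \<bullet> x) *\<^sub>R x = 0")
  case True
  have "linear (frechet_derivative (\<lambda>x::fseq. x) (at x within rsphere n))"
    using has_derivative_linear[OF frechet_derivative_works[THEN iffD1, OF differentiable_ident]] .
  then show ?thesis
    using True by (simp add: sdiff_def linear_0)
next
  case False
  define w where "w = v - (v \<bullet> x) *\<^sub>R x"
  have w: "w \<in> eucl (Suc n)" "x \<bullet> w = 0" "w \<noteq> 0"
    using x v False by (auto simp: w_def rsphere_iff inner_diff_right inner_commute intro!: eucl_closed_ops)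
  then have sw: "sgn w \<in> rsphere n" "x \<bullet> sgn w = 0"
    by (auto simp: rsphere_def norm_sgn sgn_div_norm eucl_closed_ops)
  have "((\<lambda>s. great_circle x (sgn w) s) has_vector_derivative sdiff n (\<lambda>x. x) (great_circle x (sgn w) 0) (sgn w)) (at 0)"
    using has_vector_derivative_great_circle[of x "sgn w" 0]
    by (intro sdiff_has_vector_derivative great_circle_in_rsphere x sw) auto
  then have *: "sdiff n (\<lambda>x. x) x (sgn w) = sgn w"
    using has_vector_derivative_great_circle[of x "sgn w" 0] vector_derivative_unique_at by fastforce
  have "v = norm w *\<^sub>R sgn w + (v \<bullet> x) *\<^sub>R x"
    using w(3) by (simp add: sgn_div_norm w_def)
  then have "sdiff n (\<lambda>x. x) x v = norm w *\<^sub>R sdiff n (\<lambda>x. x) x (sgn w) + (v \<bullet> x) *\<^sub>R sdiff n (\<lambda>x. x) x x"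
    by (metis sdiff_add sdiff_scale differentiable_ident)
  also have "\<dots> = w"
    using w(3) x by (simp only: * sdiff_normal[OF differentiable_ident x]) (simp add: sgn_div_norm)
  finally show ?thesis
    by (simp add: w_def)
qed

section \<open>The sphere as a closed Riemannian manifold\<close>

text \<open>A short straight segment through \<open>x\<close> in direction \<open>v\<close> stays in
  \<open>U\<close>, and its image has a unique velocity. The restriction to
  \<open>v \<in> eucl m\<close> is essential: in other directions the chosen derivative is
  arbitrary.\<close>

lemma frechet_derivative_eucl:
  assumes U: "openin (top_of_set (eucl m)) U" "x \<in> U" and v: "v \<in> eucl m"
    and D: "(f has_derivative D) (at x within U)"
  shows "frechet_derivative f (at x within U) v = D v"
proof -
  obtain e where e: "e > 0" "ball x e \<inter> eucl m \<subseteq> U" and Um: "U \<subseteq> eucl m"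
    using U by (meson openin_contains_ball)
  define d where "d = e / (norm v + 1)"
  have d: "d > 0"
    using e(1) by (simp add: d_def add_nonneg_pos)
  have T: "x + s *\<^sub>R v \<in> U" if "s \<in> {- d<..<d}" for s
  proof -
    have "\<bar>s\<bar> * norm v \<le> d * norm v"
      using that by (intro mult_right_mono) auto
    also have "\<dots> < d * (norm v + 1)"
      using d by (intro mult_strict_left_mono) auto
    also have "\<dots> = e"
      by (simp add: d_def add_nonneg_eq_0_iff)
    finally have "x + s *\<^sub>R v \<in> ball x e"
      by (simp add: dist_norm)
    moreover have "x + s *\<^sub>R v \<in> eucl m"
      using U(2) Um v by (intro eucl_closed_ops) auto
    ultimately show ?thesis
      using e(2) by blast
  qed
  have \<gamma>: "((\<lambda>s. x + s *\<^sub>R v) has_vector_derivative v) (at 0)"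
    by (auto intro!: derivative_eq_intros)
  have curve: "((\<lambda>s. f (x + s *\<^sub>R v)) has_vector_derivative E v) (at 0)"
    if "(f has_derivative E) (at x within U)" for E
    by (rule has_vector_derivative_along_curve[OF that \<gamma>, where T = "{- d<..<d}"]) (use d T in auto)
  have "(f has_derivative frechet_derivative f (at x within U)) (at x within U)"
    using D frechet_derivative_works differentiable_def by blast
  then show ?thesis
    using curve D vector_derivative_unique_at by blast
qed

section \<open>\<open>C^k\<close> calculus on relatively open subsets of
  \<open>eucl m\<close>\<close>

lemma Ck_on_cong:
  assumes "\<And>x. x \<in> U \<Longrightarrow> f x = g x"
  shows "Ck_on k m U f \<longleftrightarrow> Ck_on k m U g"
  using assms
proof (induction k arbitrary: f g)
  case 0
  then show ?case
    using continuous_on_cong[of U U f g] by simp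
next
  case (Suc k)
  have "(f has_derivative D) (at x within U) \<longleftrightarrow> (g has_derivative D) (at x within U)"
    if "x \<in> U" for x D
    using that Suc.prems has_derivative_transform[of x U g f D]
      has_derivative_transform[of x U f g D] by auto
  then show ?case
    using Suc.IH[of "\<lambda>x. frechet_derivative f (at x within U) v"
        "\<lambda>x. frechet_derivative g (at x within U) v" for v]
    by (simp add: differentiable_def frechet_derivative_def)
qed

text \<open>Allows an explicit derivative in place of the chosen one, so that the closure properties
  below follow from the usual differentiation rules by induction on the order.\<close>

lemma Ck_on_SucI:
  assumes "openin (top_of_set (eucl m)) U"
    and "\<And>x. x \<in> U \<Longrightarrow> (f has_derivative f' x) (at x within U)"
    and "\<And>i. i < m \<Longrightarrow> Ck_on k m U (\<lambda>x. f' x (unit_vec i))"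
  shows "Ck_on (Suc k) m U f"
proof -
  have "Ck_on k m U (\<lambda>x. frechet_derivative f (at x within U) (unit_vec i))" if "i < m" for i
  proof (rule Ck_on_cong[THEN iffD2, OF _ assms(3)[OF that]])
    show "frechet_derivative f (at x within U) (unit_vec i) = f' x (unit_vec i)" if "x \<in> U" for x
      using assms(1) that \<open>i < m\<close> assms(2)[OF that] by (intro frechet_derivative_eucl) auto
  qed
  then show ?thesis
    using assms(2) by (auto simp: differentiable_def)
qed

lemma Ck_on_Suc_has_derivative:
  "Ck_on (Suc k) m U f \<Longrightarrow> x \<in> U \<Longrightarrow>
    (f has_derivative frechet_derivative f (at x within U)) (at x within U)"
  by (simp add: frechet_derivative_works)

lemma Ck_on_Suc_imp: "Ck_on (Suc k) m U f \<Longrightarrow> Ck_on k m U f"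
proof (induction k arbitrary: f)
  case 0
  then show ?case
    by (simp add: continuous_on_eq_continuous_within differentiable_imp_continuous_within)
next
  case (Suc k)
  then show ?case
    by (subst (asm) (2) Ck_on.simps, subst Ck_on.simps) blast
qed

lemma Ck_on_add:
  assumes "openin (top_of_set (eucl m)) U" "Ck_on k m U f" "Ck_on k m U g"
  shows "Ck_on k m U (\<lambda>x. f x + g x)"
  using assms(2,3)
proof (induction k arbitrary: f g)
  case 0
  then show ?case
    by (simp add: continuous_on_add)
next
  case (Suc k)
  then show ?case
    by (intro Ck_on_SucI[OF assms(1) has_derivative_add[OF Ck_on_Suc_has_derivative
            Ck_on_Suc_has_derivative]] Suc.IH) auto
qed

text \<open>The product rule expresses a partial derivative as a sum of two products, each with one
  factor differentiated, and the induction hypothesis applies after lowering the order of the other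
  factor. One proof serves multiplication, scaling and the inner product.\<close>

lemma (in bounded_bilinear) Ck_on:
  assumes "openin (top_of_set (eucl m)) U" "Ck_on k m U f" "Ck_on k m U g"
  shows "Ck_on k m U (\<lambda>x. prod (f x) (g x))"
  using assms(2,3)
proof (induction k arbitrary: f g)
  case 0
  then show ?case
    by (simp add: continuous_on)
next
  case (Suc k)
  note Ck = Suc.prems[THEN Ck_on_Suc_imp]
  show ?case
    using Suc.prems Ck
    by (intro Ck_on_SucI[OF assms(1) FDERIV[OF Ck_on_Suc_has_derivative
            Ck_on_Suc_has_derivative]] Ck_on_add[OF assms(1)] Suc.IH) auto
qed

lemma Ck_on_const: "openin (top_of_set (eucl m)) U \<Longrightarrow> Ck_on k m U (\<lambda>x. c)"
proof (induction k arbitrary: c)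
  case (Suc k)
  then show ?case
    by (intro Ck_on_SucI[OF _ has_derivative_const]) auto
qed simp

lemma Ck_on_bounded_linear:
  assumes U: "openin (top_of_set (eucl m)) U" and f: "bounded_linear f"
  shows "Ck_on k m U f"
proof (cases k)
  case 0
  then show ?thesis
    using bounded_linear.continuous_on[OF f continuous_on_id] by simp
next
  case (Suc l)
  show ?thesis
    unfolding Suc
    by (intro Ck_on_SucI[OF U bounded_linear.has_derivative[OF f has_derivative_ident]]
        Ck_on_const U)
qed

text \<open>The derivative of \<open>1/f\<close> is a product of \<open>1/f\<close>,
  \<open>f'\<close> and \<open>1/f\<close>, so the induction only needs \<open>1/f\<close> at the
  previous order.\<close>

lemma Ck_on_inverse:
  fixes f :: "fseq \<Rightarrow> real"
  assumes U: "openin (top_of_set (eucl m)) U" and "Ck_on k m U f" "\<And>x. x \<in> U \<Longrightarrow> f x \<noteq> 0"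
  shows "Ck_on k m U (\<lambda>x. inverse (f x))"
  using assms(2)
proof (induction k)
  case 0
  then show ?case
    using assms(3) by (simp add: continuous_on_inverse)
next
  case (Suc k)
  note IH = Suc.IH[OF Ck_on_Suc_imp[OF Suc.prems]]
  note mult = bounded_bilinear.Ck_on[OF bounded_bilinear_mult U]
  have "Ck_on k m U (\<lambda>x. - 1 * (inverse (f x) * frechet_derivative f (at x within U) (unit_vec i)
      * inverse (f x)))" if "i < m" for i
    using that Suc.prems by (intro mult Ck_on_const U IH) auto
  then show ?case
    using assms(3) Suc.prems
    by (intro Ck_on_SucI[OF U Deriv.has_derivative_inverse[OF _ Ck_on_Suc_has_derivative]]) auto
qed

section \<open>Stereographic charts of the sphere\<close>

text \<open>The pole is \<open>s *\<^sub>R unit_vec m\<close> with \<open>s = \<plusminus>1\<close>.\<close>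

definition stereo_inv :: "nat \<Rightarrow> real \<Rightarrow> fseq \<Rightarrow> fseq"
  where "stereo_inv m s y =
    inverse (1 + y \<bullet> y) *\<^sub>R (2 *\<^sub>R y + (s * (y \<bullet> y - 1)) *\<^sub>R unit_vec m)"

definition stereo :: "nat \<Rightarrow> real \<Rightarrow> fseq \<Rightarrow> fseq"
  where "stereo m s x = inverse (1 - s * coord x m) *\<^sub>R (x - coord x m *\<^sub>R unit_vec m)"

lemma one_plus_inner_pos [simp]: "0 < 1 + (y::fseq) \<bullet> y" "1 + (y::fseq) \<bullet> y \<noteq> 0"
  using inner_ge_zero[of y] by linarith+

lemma coord_eucl_0: "y \<in> eucl m \<Longrightarrow> coord y m = 0"
  by (simp add: eucl_def)

lemma stereo_inv_in_rsphere:
  assumes s: "s * s = 1" and y: "y \<in> eucl m"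
  shows "stereo_inv m s y \<in> rsphere m" "s * coord (stereo_inv m s y) m \<noteq> 1"
proof -
  define r where "r = y \<bullet> y"
  have r: "1 + r > 0"
    by (simp add: r_def)
  have "stereo_inv m s y \<in> eucl (Suc m)"
    using y eucl_mono[of m "Suc m"] unfolding stereo_inv_def by (intro eucl_closed_ops) auto
  moreover have "(2 *\<^sub>R y + k *\<^sub>R unit_vec m) \<bullet> (2 *\<^sub>R y + k *\<^sub>R unit_vec m) = 4 * r + k * k" for k
    using coord_eucl_0[OF y] by (simp add: inner_add_left inner_add_right inner_unit_vec
        inner_commute[of "unit_vec m"] r_def)
  then have "stereo_inv m s y \<bullet> stereo_inv m s y =
      inverse (1 + r) * (inverse (1 + r) * (4 * r + (s * (r - 1)) * (s * (r - 1))))"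
    unfolding stereo_inv_def r_def[symmetric] by (simp only: inner_scaleR_left inner_scaleR_right)
  \<comment> \<open>The sign squares away and \<open>4 * r + (r - 1)^2 = (1 + r)^2\<close>, which
    cancels the normalising factor.\<close>
  moreover have "4 * r + (s * (r - 1)) * (s * (r - 1)) = 4 * r + (s * s) * ((r - 1) * (r - 1))"
    by (simp only: ac_simps)
  moreover have "\<dots> = (1 + r) * (1 + r)"
    by (simp add: s algebra_simps)
  moreover have "inverse (1 + r) * (inverse (1 + r) * ((1 + r) * (1 + r))) = 1"
    using r by (simp add: mult.assoc[symmetric])
  ultimately have "stereo_inv m s y \<in> eucl (Suc m)" "stereo_inv m s y \<bullet> stereo_inv m s y = 1"
    by simp_all
  then show "stereo_inv m s y \<in> rsphere m"
    by (simp add: rsphere_iff)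
  have "s * coord (stereo_inv m s y) m = (s * s) * ((r - 1) / (1 + r))"
    using coord_eucl_0[OF y] by (simp add: stereo_inv_def r_def divide_inverse algebra_simps)
  then show "s * coord (stereo_inv m s y) m \<noteq> 1"
    using r by (simp add: s)
qed

lemma stereo_stereo_inv:
  assumes s: "s * s = 1" and y: "y \<in> eucl m"
  shows "stereo m s (stereo_inv m s y) = y"
proof -
  define r where "r = y \<bullet> y"
  have r: "1 + r > 0"
    by (simp add: r_def)
  have "s * coord (stereo_inv m s y) m = (s * s) * ((r - 1) / (1 + r))"
    using coord_eucl_0[OF y] by (simp add: stereo_inv_def r_def divide_inverse algebra_simps)
  then have "1 - s * coord (stereo_inv m s y) m = 2 / (1 + r)"
    using r by (simp add: s field_simps)
  moreover have "stereo_inv m s y - coord (stereo_inv m s y) m *\<^sub>R unit_vec m = (2 / (1 + r)) *\<^sub>R y"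
    using coord_eucl_0[OF y] by (auto intro!: fseq_eqI simp: stereo_inv_def r_def[symmetric] divide_inverse)
  moreover have "inverse (2 / (1 + r)) * (2 / (1 + r)) = 1"
    using r by (intro left_inverse) simp
  ultimately show ?thesis
    by (simp only: stereo_def scaleR_scaleR scaleR_one)
qed

lemma stereo_in_eucl: "x \<in> rsphere m \<Longrightarrow> stereo m s x \<in> eucl m"
proof -
  assume "x \<in> rsphere m"
  then have "coord x i = 0" if "i \<ge> m" "i \<noteq> m" for i
    using that by (simp add: rsphere_iff eucl_def)
  then show ?thesis
    by (auto simp: stereo_def eucl_def)
qed

lemma stereo_inv_stereo:
  assumes s: "s * s = 1" and x: "x \<in> rsphere m" "s * coord x m \<noteq> 1"
  shows "stereo_inv m s (stereo m s x) = x"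
proof -
  define a where "a = s * coord x m"
  have a: "1 - a \<noteq> 0" and xa: "coord x m = s * a"
    using x s by (simp_all add: a_def mult.assoc[symmetric])
  have "stereo m s x \<bullet> stereo m s x = inverse (1 - a) * inverse (1 - a) * (1 - coord x m * coord x m)"
    using x(1) by (simp add: stereo_def inner_diff_left inner_diff_right inner_unit_vec
        inner_commute[of "unit_vec m"] a_def[symmetric] rsphere_iff)
  also have "1 - coord x m * coord x m = 1 - (s * s) * (a * a)"
    by (simp add: xa)
  also have "\<dots> = (1 - a) * (1 + a)"
    by (simp add: s algebra_simps)
  also have "inverse (1 - a) * inverse (1 - a) * ((1 - a) * (1 + a)) = (1 + a) / (1 - a)"
    using a by (simp add: divide_inverse)
  finally have r: "stereo m s x \<bullet> stereo m s x = (1 + a) / (1 - a)" .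
  \<comment> \<open>\<open>K\<close> is the value of \<open>1 + y \<bullet> y\<close> at
    \<open>y = stereo m s x\<close>, because \<open>y \<bullet> y = (1 + a) / (1 - a)\<close>;
    \<open>v\<close> is the part of \<open>x\<close> orthogonal to the axis.\<close>
  define K v where "K = 2 / (1 - a)" and "v = x - coord x m *\<^sub>R unit_vec m"
  have K: "1 + (1 + a) / (1 - a) = K" "K \<noteq> 0"
    using a by (simp_all add: K_def field_simps)
  have "(1 + a) / (1 - a) - 1 = K * a"
    using a by (simp add: K_def field_simps)
  then have sK: "s * ((1 + a) / (1 - a) - 1) = K * coord x m"
    by (simp add: xa)
  have "stereo m s x = inverse (1 - a) *\<^sub>R v"
    by (simp only: stereo_def a_def v_def)
  then have "2 *\<^sub>R stereo m s x = K *\<^sub>R v"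
    by (simp add: K_def divide_inverse)
  then have "stereo_inv m s (stereo m s x) =
      inverse K *\<^sub>R (K *\<^sub>R v + (K * coord x m) *\<^sub>R unit_vec m)"
    by (simp only: stereo_inv_def r K sK)
  also have "K *\<^sub>R v + (K * coord x m) *\<^sub>R unit_vec m = K *\<^sub>R x"
    by (simp add: v_def scaleR_diff_right)
  finally show ?thesis
    using K(2) by simp
qed

lemma stereo_inv_image:
  assumes "s * s = 1"
  shows "stereo_inv m s ` eucl m = {x \<in> rsphere m. s * coord x m \<noteq> 1}"
proof (intro subset_antisym subsetI)
  fix x assume "x \<in> {x \<in> rsphere m. s * coord x m \<noteq> 1}"
  then show "x \<in> stereo_inv m s ` eucl m"
    using stereo_inv_stereo[OF assms] stereo_in_eucl by (metis (mono_tags) image_eqI mem_Collect_eq)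
qed (use stereo_inv_in_rsphere[OF assms] in auto)

lemma stereo_has_derivative:
  assumes "s * coord x m \<noteq> 1"
  shows "\<exists>D. (stereo m s has_derivative D) (at x within S)"
proof -
  note coord = bounded_linear.has_derivative[OF bounded_linear_coord has_derivative_ident]
  have "((\<lambda>x. inverse (1 - s * coord x m)) has_derivative
      (\<lambda>h. - (inverse (1 - s * coord x m) * (0 - s * coord h m) * inverse (1 - s * coord x m))))
      (at x within S)"
    using assms by (intro Deriv.has_derivative_inverse has_derivative_diff has_derivative_const
        has_derivative_mult_right coord) auto
  moreover have "((\<lambda>x. x - coord x m *\<^sub>R unit_vec m) has_derivative
      (\<lambda>h. h - coord h m *\<^sub>R unit_vec m)) (at x within S)"
    by (intro has_derivative_diff has_derivative_ident has_derivative_scaleR_left coord)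
  from has_derivative_scaleR[OF calculation this] show ?thesis
    unfolding stereo_def[abs_def] by blast
qed

lemma openin_eucl_self: "openin (top_of_set (eucl m)) (eucl m)"
  by simp

lemma smooth_stereo_inv: "smooth_on m (eucl m) (stereo_inv m s)"
  unfolding smooth_on_def
proof
  fix k
  note U = openin_eucl_self[of m]
  note id = Ck_on_bounded_linear[OF U bounded_linear_ident, of k]
  note inner = bounded_bilinear.Ck_on[OF bounded_bilinear_inner U id id]
  have "Ck_on k m (eucl m) (\<lambda>y. inverse (1 + y \<bullet> y) *\<^sub>R
      (2 *\<^sub>R y + (s * (y \<bullet> y + - 1)) *\<^sub>R unit_vec m))"
    by (intro bounded_bilinear.Ck_on[OF bounded_bilinear_scaleR U]
        bounded_bilinear.Ck_on[OF bounded_bilinear_mult U] Ck_on_inverse[OF U]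
        Ck_on_add[OF U] Ck_on_const[OF U] id inner) simp
  then show "Ck_on k m (eucl m) (stereo_inv m s)"
    by (simp add: stereo_inv_def[abs_def])
qed

lemma local_param_stereo_inv:
  assumes s: "s * s = 1"
  shows "local_param m (rsphere m) (eucl m) (stereo_inv m s)"
  unfolding local_param_def
proof (intro conjI ballI smooth_stereo_inv openin_eucl_self exI[of _ "stereo m s"])
  have "stereo_inv m s ` eucl m = rsphere m \<inter> {x. s * coord x m \<noteq> 1}"
    unfolding stereo_inv_image[OF s] by auto
  moreover have "open {x. s * coord x m \<noteq> 1}"
    by (intro open_Collect_neq continuous_intros)
  ultimately show "openin (top_of_set (rsphere m)) (stereo_inv m s ` eucl m)"
    by (simp add: openin_open_Int)
next
  fix y assume y: "y \<in> eucl m"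
  let ?D = "frechet_derivative (stereo_inv m s) (at y within eucl m)"
  have D: "(stereo_inv m s has_derivative ?D) (at y within eucl m)"
    using smooth_stereo_inv[unfolded smooth_on_def, rule_format] y by (rule Ck_on_Suc_has_derivative)
  then have lin: "linear ?D"
    by (rule has_derivative_linear)
  obtain E where E: "(stereo m s has_derivative E) (at (stereo_inv m s y))"
    using stereo_has_derivative[of s "stereo_inv m s y" m UNIV] stereo_inv_in_rsphere(2)[OF s y] by auto
  \<comment> \<open>A direction annihilated by the derivative is tested on the straight line through
    \<open>y\<close>: composing with the left inverse \<open>stereo m s\<close>, which is
    differentiable at the image point in the ambient space, gives back the line, whose velocity
    \<open>z\<close> must then vanish.\<close>
  have "z = 0" if z: "z \<in> eucl m" "?D z = 0" for z
  proof -
    let ?\<gamma> = "\<lambda>t. y + t *\<^sub>R z"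
    have \<gamma>: "(?\<gamma> has_vector_derivative z) (at 0)"
      by (auto intro!: derivative_eq_intros)
    have in_eucl: "?\<gamma> t \<in> eucl m" for t
      using y z(1) by (intro eucl_closed_ops)
    have "((\<lambda>t. stereo_inv m s (?\<gamma> t)) has_vector_derivative 0) (at 0)"
      using has_vector_derivative_along_global_curve[of "stereo_inv m s" ?D ?\<gamma> 0 "eucl m" z]
        D \<gamma> in_eucl z(2) by simp
    then have "((\<lambda>t. stereo m s (stereo_inv m s (?\<gamma> t))) has_vector_derivative E 0) (at 0)"
      using has_vector_derivative_along_global_curve[of "stereo m s" E
          "\<lambda>t. stereo_inv m s (?\<gamma> t)" 0 UNIV 0] E by simp
    then have "(?\<gamma> has_vector_derivative E 0) (at 0)"
      by (simp add: stereo_stereo_inv[OF s in_eucl])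
    then show "z = 0"
      using vector_derivative_unique_at[OF \<gamma>] linear_0[OF has_derivative_linear[OF E]] by simp
  qed
  then show "inj_on ?D (eucl m)"
    using linear_injective_on_subspace_0[OF lin subspace_eucl] by blast
next
  show "homeomorphism (eucl m) (stereo_inv m s ` eucl m) (stereo_inv m s) (stereo m s)"
  proof (intro homeomorphismI)
    show "continuous_on (eucl m) (stereo_inv m s)"
      using smooth_stereo_inv[of m s] by (auto simp: smooth_on_def dest!: spec[of _ 0])
    show "continuous_on (stereo_inv m s ` eucl m) (stereo m s)"
      unfolding stereo_inv_image[OF s] stereo_def[abs_def] by (intro continuous_intros) auto
  qed (auto simp: stereo_stereo_inv[OF s])
qed

lemma ex_pole:
  obtains s where "s * s = 1" "s * coord p m \<noteq> (1::real)"
proof (cases "coord p m = 1")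
  case True
  then show ?thesis
    by (intro that[of "- 1"]) auto
next
  case False
  then show ?thesis
    by (intro that[of 1]) auto
qed

lemma submanifold_rsphere: "submanifold m (rsphere m)"
  unfolding submanifold_def
proof (intro conjI ballI exI[of _ "Suc m"])
  fix p assume "p \<in> rsphere m"
  moreover obtain s where "s * s = 1" "s * coord p m \<noteq> 1"
    by (rule ex_pole)
  ultimately show "\<exists>U \<phi>. local_param m (rsphere m) U \<phi> \<and> p \<in> \<phi> ` U"
    using local_param_stereo_inv stereo_inv_image by (metis (mono_tags, lifting) mem_Collect_eq)
qed (auto simp: rsphere_iff)

text \<open>The metric has to be smooth in all local parametrisations, not just the stereographic
  ones. Its coefficients are inner products of first derivatives of \<open>\<phi>\<close>, so order
  \<open>l\<close> for them comes from order \<open>Suc l\<close> for \<open>\<phi>\<close>.\<close>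

lemma closed_riemannian_rsphere:
  assumes "m \<ge> 1" "c > 0"
  shows "closed_riemannian (rsphere m, \<lambda>p v w. c * (v \<bullet> w))"
  unfolding closed_riemannian_def fst_conv snd_conv
proof (intro conjI exI[of _ m] submanifold_rsphere compact_rsphere connected_rsphere assms(1))
  show "rsphere m \<noteq> {}"
    using unit_vec_in_rsphere[of 0 m] by auto
  show "riemannian_metric (rsphere m) (\<lambda>p v w. c * (v \<bullet> w))"
    unfolding riemannian_metric_def
  proof (intro conjI ballI allI impI)
    fix k U \<phi> i j assume \<phi>: "local_param k (rsphere m) U \<phi>" and "i < k" "j < k"
    then have U: "openin (top_of_set (eucl k)) U" and "\<And>l. Ck_on (Suc l) k U \<phi>"
      by (auto simp: local_param_def smooth_on_def simp del: Ck_on.simps)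
    then show "smooth_on k U (\<lambda>y. c * (frechet_derivative \<phi> (at y within U) (unit_vec i) \<bullet>
        frechet_derivative \<phi> (at y within U) (unit_vec j)))"
      unfolding smooth_on_def using \<open>i < k\<close> \<open>j < k\<close>
      by (intro allI bounded_bilinear.Ck_on[OF bounded_bilinear_mult U]
          bounded_bilinear.Ck_on[OF bounded_bilinear_inner U] Ck_on_const[OF U]) auto
  qed (use assms(2) in \<open>auto simp: inner_commute inner_add_left algebra_simps\<close>)
qed

text \<open>\<open>smooth_map\<close> speaks of \<open>f\<close> only through charts. Away from the
  pole \<open>f\<close> equals \<open>(f \<circ> stereo_inv m s) \<circ> stereo m s\<close>, and
  removing the pole does not affect the filter of neighbourhoods of \<open>p\<close> within the
  sphere.\<close>

lemma smooth_map_imp_differentiable: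
  assumes f: "smooth_map (rsphere m) f" and p: "p \<in> rsphere m"
  shows "f differentiable (at p within rsphere m)"
proof -
  obtain s where s: "s * s = 1" "s * coord p m \<noteq> 1"
    by (rule ex_pole)
  let ?O = "{x. s * coord x m \<noteq> 1}"
  have "smooth_on m (eucl m) (f \<circ> stereo_inv m s)"
    using f local_param_stereo_inv[OF s(1)] by (auto simp: smooth_map_def)
  then have "Ck_on (Suc 0) m (eucl m) (f \<circ> stereo_inv m s)"
    unfolding smooth_on_def by blast
  then have 1: "(f \<circ> stereo_inv m s) differentiable (at (stereo m s p) within eucl m)"
    using stereo_in_eucl[OF p] by simp
  have 2: "stereo m s differentiable (at p within rsphere m \<inter> ?O)"
    using stereo_has_derivative[OF s(2)] by (simp add: differentiable_def)
  have "((f \<circ> stereo_inv m s) \<circ> stereo m s) differentiable (at p within rsphere m \<inter> ?O)"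
    using stereo_in_eucl
    by (intro differentiable_chain_within 2 differentiable_within_subset[OF 1]) auto
  then obtain D where "((f \<circ> stereo_inv m s) \<circ> stereo m s has_derivative D) (at p within rsphere m \<inter> ?O)"
    by (auto simp: differentiable_def)
  then have "(f has_derivative D) (at p within rsphere m \<inter> ?O)"
    using p s by (intro has_derivative_transform[of p "rsphere m \<inter> ?O" f]) (auto simp: stereo_inv_stereo)
  moreover have "open ?O"
    by (intro open_Collect_neq continuous_intros)
  then have "at p within (rsphere m \<inter> ?O) = at p within rsphere m"
    using s(2) by (intro at_within_nhd[of p ?O]) auto
  ultimately show ?thesis
    by (auto simp: differentiable_def)
qed

section \<open>Spheres of different scales are not isometric\<close>

text \<open>
  A great circle arc joining the preimages of two antipodal points has length at most \<open>\<pi>\<close>, so the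
  points would be connected by a curve of length at most \<open>\<pi> / 2 < 2\<close>.
\<close>

lemma no_half_contraction:
  assumes a: "a \<ge> 1" and onto: "rsphere b \<subseteq> f ` rsphere a"
    and diff: "\<And>p. p \<in> rsphere a \<Longrightarrow> f differentiable (at p within rsphere a)"
    and bound: "\<And>\<gamma> t v w. (\<And>s. \<gamma> s \<in> rsphere a) \<Longrightarrow> (\<gamma> has_vector_derivative v) (at t) \<Longrightarrow>
      ((\<lambda>s. f (\<gamma> s)) has_vector_derivative w) (at t) \<Longrightarrow> norm w \<le> norm v / 2"
  shows False
proof -
  have e: "unit_vec 0 \<in> rsphere b"
    by (rule unit_vec_in_rsphere) simp
  then have e': "- unit_vec 0 \<in> rsphere b"
    using subspace_neg[OF subspace_eucl] by (simp only: rsphere_iff inner_minus_left inner_minus_right minus_minus)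
  obtain p q where pq: "p \<in> rsphere a" "q \<in> rsphere a" "f p = unit_vec 0" "f q = - unit_vec 0"
    using subsetD[OF onto e] subsetD[OF onto e'] by (metis imageE)
  obtain w T where w: "w \<in> rsphere a" "p \<bullet> w = 0" and T: "0 \<le> T" "T \<le> pi" "great_circle p w T = q"
    using ex_great_circle[OF pq(1,2) a] .
  let ?\<gamma> = "great_circle p w"
  have in_sphere: "?\<gamma> s \<in> rsphere a" for s
    using pq(1) w by (rule great_circle_in_rsphere)
  have "\<exists>w'. ((\<lambda>s. f (?\<gamma> s)) has_vector_derivative w') (at t) \<and> norm w' \<le> 1 / 2" for t
  proof -
    let ?v = "cos t *\<^sub>R w - sin t *\<^sub>R p"
    have "((\<lambda>s. f (?\<gamma> s)) has_vector_derivative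
        frechet_derivative f (at (?\<gamma> t) within rsphere a) ?v) (at t)"
      by (rule has_vector_derivative_along_global_curve[OF diff[unfolded frechet_derivative_works]
            has_vector_derivative_great_circle in_sphere, OF in_sphere])
    with bound[OF in_sphere has_vector_derivative_great_circle this] show ?thesis
      using norm_great_circle_velocity[OF pq(1) w, of t] by auto
  qed
  then obtain f' where f': "((\<lambda>s. f (?\<gamma> s)) has_vector_derivative f' t) (at t)" "norm (f' t) \<le> 1 / 2" for t
    by metis
  have "norm (f (?\<gamma> T) - f (?\<gamma> 0)) \<le> 1 / 2 * norm (T - 0)"
  proof (rule differentiable_bound[of UNIV])
    show "((\<lambda>s. f (?\<gamma> s)) has_derivative (\<lambda>h. h *\<^sub>R f' t)) (at t)" for t
      using f'(1) by (simp add: has_vector_derivative_def)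
    show "onorm (\<lambda>h. h *\<^sub>R f' t) \<le> 1 / 2" for t
    proof (rule onorm_le)
      show "norm (h *\<^sub>R f' t) \<le> 1 / 2 * norm h" for h
        using mult_left_mono[OF f'(2)[of t], of "\<bar>h\<bar>"] by simp
    qed
  qed auto
  also have "\<dots> \<le> pi / 2"
    using T by simp
  also have "\<dots> < 2"
    using pi_less_4 by simp
  finally have "norm (- unit_vec 0 - unit_vec 0 :: fseq) < 2"
    using T(3) pq(3,4) by simp
  moreover have "- unit_vec 0 - unit_vec 0 = (- 2) *\<^sub>R unit_vec 0"
    by (auto intro!: fseq_eqI)
  ultimately show False
    by simp
qed

lemma has_vector_derivative_in_tangent_space:
  assumes "\<And>s. \<gamma> s \<in> M" "(\<gamma> has_vector_derivative v) (at t)"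
  shows "v \<in> tangent_space M (\<gamma> t)"
proof -
  have "((\<lambda>s. s + t) has_real_derivative 1) (at 0)"
    by (auto intro!: derivative_eq_intros)
  then have "((\<gamma> \<circ> (\<lambda>s. s + t)) has_vector_derivative (1 *\<^sub>R v)) (at 0)"
    using assms(2)
    by (intro vector_diff_chain_at) (auto simp: has_real_derivative_iff_has_vector_derivative)
  then show ?thesis
    using assms(1) by (auto simp: tangent_space_def o_def intro!: exI[of _ "\<lambda>s. \<gamma> (s + t)"])
qed

lemma not_isometric_rspheres:
  assumes "a \<ge> 1" "b \<ge> 1" "c > 0" "d > 0" and cd: "4 * c \<le> d \<or> 4 * d \<le> c"
  shows "\<not> isometric (rsphere a, \<lambda>p v w. c * (v \<bullet> w)) (rsphere b, \<lambda>p v w. d * (v \<bullet> w))"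
proof
  assume "isometric (rsphere a, \<lambda>p v w. c * (v \<bullet> w)) (rsphere b, \<lambda>p v w. d * (v \<bullet> w))"
  then obtain f g where hom: "homeomorphism (rsphere a) (rsphere b) f g"
    and smooth: "smooth_map (rsphere a) f" "smooth_map (rsphere b) g"
    and iso: "\<And>p v. p \<in> rsphere a \<Longrightarrow> v \<in> tangent_space (rsphere a) p \<Longrightarrow>
      d * (frechet_derivative f (at p within rsphere a) v \<bullet>
        frechet_derivative f (at p within rsphere a) v) = c * (v \<bullet> v)"
    by (auto simp: isometric_def)
  note diff = smooth[THEN smooth_map_imp_differentiable]
  have iso_curve: "d * (w \<bullet> w) = c * (v \<bullet> v)"
    if "\<And>s. \<gamma> s \<in> rsphere a" "(\<gamma> has_vector_derivative v) (at t)"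
      "((\<lambda>s. f (\<gamma> s)) has_vector_derivative w) (at t)" for \<gamma> t v w
  proof -
    have "((\<lambda>s. f (\<gamma> s)) has_vector_derivative
        frechet_derivative f (at (\<gamma> t) within rsphere a) v) (at t)"
      by (rule has_vector_derivative_along_global_curve[OF
            diff(1)[unfolded frechet_derivative_works] that(2,1), OF that(1)])
    then have "w = frechet_derivative f (at (\<gamma> t) within rsphere a) v"
      using that(3) vector_derivative_unique_at by blast
    then show ?thesis
      using iso[OF that(1) has_vector_derivative_in_tangent_space[OF that(1,2)]] by simp
  qed
  \<comment> \<open>A factor 4 between the scales of the metrics is a factor 2 between
    lengths.\<close>
  have half: "norm w \<le> norm v / 2" if "d' * (w \<bullet> w) = c' * (v \<bullet> v)" "4 * c' \<le> d'" "c' > 0"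
    for c' d' :: real and v w :: fseq
  proof -
    have "4 * c' * (w \<bullet> w) \<le> c' * (v \<bullet> v)"
      using mult_right_mono[OF that(2) inner_ge_zero[of w]] that(1) by simp
    then have "(2 * norm w)\<^sup>2 \<le> (norm v)\<^sup>2"
      using that(3) by (simp add: power_mult_distrib power2_norm_eq_inner)
    then show ?thesis
      using power2_le_imp_le[of "2 * norm w" "norm v"] by simp
  qed
  from cd show False
  proof
    assume "4 * c \<le> d"
    show False
    proof (rule no_half_contraction[OF \<open>a \<ge> 1\<close> _ diff(1)])
      show "rsphere b \<subseteq> f ` rsphere a"
        using hom by (simp add: homeomorphism_def)
    next
      fix \<gamma> t v w
      assume "\<And>s. \<gamma> s \<in> rsphere a" "(\<gamma> has_vector_derivative v) (at t)"
        "((\<lambda>s. f (\<gamma> s)) has_vector_derivative w) (at t)"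
      then show "norm w \<le> norm v / 2"
        using half[OF iso_curve \<open>4 * c \<le> d\<close> \<open>c > 0\<close>] by blast
    qed
  next
    assume "4 * d \<le> c"
    show False
    proof (rule no_half_contraction[OF \<open>b \<ge> 1\<close> _ diff(2)])
      show "rsphere a \<subseteq> g ` rsphere b"
        using hom by (simp add: homeomorphism_def)
    next
      fix \<gamma> t v w
      assume *: "\<And>s. \<gamma> s \<in> rsphere b" "(\<gamma> has_vector_derivative v) (at t)"
        "((\<lambda>s. g (\<gamma> s)) has_vector_derivative w) (at t)"
      \<comment> \<open>The isometry condition concerns \<open>f\<close> alone. It is applied to the
        curve \<open>g \<circ> \<gamma>\<close>, which \<open>f\<close> carries back to
        \<open>\<gamma>\<close>.\<close>
      have "g (\<gamma> s) \<in> rsphere a" "f (g (\<gamma> s)) = \<gamma> s" for s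
        using hom *(1)[of s] by (auto simp: homeomorphism_def)
      then have "d * (v \<bullet> v) = c * (w \<bullet> w)"
        using iso_curve[of "\<lambda>s. g (\<gamma> s)" w t v] * by simp
      then show "norm w \<le> norm v / 2"
        using half[OF _ \<open>4 * d \<le> c\<close> \<open>d > 0\<close>] by simp
    qed
  qed
qed

section \<open>Rotation invariance of the measure on the sphere\<close>

abbreviation lborel_pow :: "nat \<Rightarrow> (nat \<Rightarrow> real) measure"
  where "lborel_pow k \<equiv> \<Pi>\<^sub>M i\<in>{..<k}. lborel"

abbreviation vec_of_coords :: "nat \<Rightarrow> (nat \<Rightarrow> real) \<Rightarrow> fseq"
  where "vec_of_coords k x \<equiv> \<Sum>i<k. x i *\<^sub>R unit_vec i"

interpretation lborel_product: product_sigma_finite "\<lambda>_::nat. lborel :: real measure"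
  by standard

text \<open>By Fubini the coordinate \<open>i\<close> is integrated innermost. With the others
  fixed, the shear translates that coordinate by the constant \<open>c * x j\<close>, and Lebesgue
  measure on the line is translation invariant.\<close>

lemma distr_lborel_pow_shear:
  assumes ij: "i < k" "j < k" "i \<noteq> j"
  shows "distr (lborel_pow k) (lborel_pow k) (\<lambda>x. x(i := x i + c * x j)) = lborel_pow k"
proof (rule measure_eqI)
  let ?S = "\<lambda>x::nat \<Rightarrow> real. x(i := x i + c * x j)"
  let ?I = "{..<k} - {i}"
  have [measurable]: "?S \<in> measurable (lborel_pow k) (lborel_pow k)"
    by (rule measurable_fun_upd[where J = "{..<k}"]) (use ij in \<open>auto intro!: measurable_component_singleton borel_measurable_add borel_measurable_times measurable_ident_sets\<close>)
  have I: "insert i ?I = {..<k}" "finite ?I" "i \<notin> ?I"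
    using ij by auto
  fix A assume "A \<in> sets (distr (lborel_pow k) (lborel_pow k) ?S)"
  then have A[measurable]: "A \<in> sets (lborel_pow k)"
    by simp
  have ind: "(\<lambda>y. indicator A (x(i := y)) :: ennreal) \<in> borel_measurable borel"
    if "x \<in> space (PiM ?I (\<lambda>_. lborel))" for x
  proof -
    have "(\<lambda>y. x(i := y)) \<in> measurable lborel (PiM (insert i ?I) (\<lambda>_. lborel))"
      using that I by (intro measurable_component_update) auto
    then have "(\<lambda>y. x(i := y)) \<in> measurable borel (lborel_pow k)"
      unfolding I(1) by simp
    then show ?thesis
      by measurable
  qed
  have "emeasure (distr (lborel_pow k) (lborel_pow k) ?S) A = (\<integral>\<^sup>+x. indicator A x \<partial>distr (lborel_pow k) (lborel_pow k) ?S)"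
    by simp
  also have "\<dots> = (\<integral>\<^sup>+x. indicator A (?S x) \<partial>lborel_pow k)"
    by (rule nn_integral_distr) measurable
  also have "\<dots> = (\<integral>\<^sup>+x. \<integral>\<^sup>+y. indicator A (?S (x(i := y))) \<partial>lborel \<partial>PiM ?I (\<lambda>_. lborel))"
    using lborel_product.product_nn_integral_insert[OF I(2,3), of "\<lambda>x. indicator A (?S x)"]
    unfolding I(1) by measurable
  also have "\<dots> = (\<integral>\<^sup>+x. \<integral>\<^sup>+y. indicator A (x(i := y)) \<partial>lborel \<partial>PiM ?I (\<lambda>_. lborel))"
  proof (rule nn_integral_cong)
    fix x assume "x \<in> space (PiM ?I (\<lambda>_. lborel :: real measure))"
    from nn_integral_real_affine[OF ind[OF this], of 1 "c * x j"]
    show "(\<integral>\<^sup>+y. indicator A (?S (x(i := y))) \<partial>lborel) = (\<integral>\<^sup>+y. indicator A (x(i := y)) \<partial>lborel)"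
      using ij by (simp add: add.commute)
  qed
  also have "\<dots> = (\<integral>\<^sup>+x. indicator A x \<partial>lborel_pow k)"
    using lborel_product.product_nn_integral_insert[OF I(2,3), of "indicator A"]
    unfolding I(1) by simp
  finally show "emeasure (distr (lborel_pow k) (lborel_pow k) ?S) A = emeasure (lborel_pow k) A"
    by simp
qed simp

lemma measurable_vec_of_coords [measurable]: "vec_of_coords k \<in> borel_measurable (lborel_pow k)"
proof -
  \<comment> \<open>Extension by zero leads from the finite product to all sequences with the
    product topology, where \<open>vec_of_coords k\<close> is continuous and hence Borel.\<close>
  have [measurable]: "(\<lambda>x i. if i < k then x i else 0 :: real) \<in> borel_measurable (lborel_pow k)"
  proof (rule measurable_coordinatewise_then_product)
    fix i
    show "(\<lambda>x. if i < k then x i else 0 :: real) \<in> borel_measurable (lborel_pow k)"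
    proof (cases "i < k")
      case True
      then have "(\<lambda>x. x i) \<in> measurable (lborel_pow k) lborel"
        by (intro measurable_component_singleton) simp
      then show ?thesis
        using True by simp
    qed simp
  qed
  have "vec_of_coords k \<in> borel_measurable borel"
    by (intro borel_measurable_continuous_onI continuous_intros continuous_on_product_coordinates)
  then have "(\<lambda>x. vec_of_coords k (\<lambda>i. if i < k then x i else 0)) \<in> borel_measurable (lborel_pow k)"
    by measurable
  then show ?thesis
    by simp
qed

section \<open>Shears and rotations of coordinate planes\<close>

definition shear :: "nat \<Rightarrow> nat \<Rightarrow> real \<Rightarrow> fseq \<Rightarrow> fseq"
  where "shear i j c x = x + (c * coord x j) *\<^sub>R unit_vec i"

lemma measurable_shear [measurable]: "shear i j c \<in> borel_measurable borel"
  unfolding shear_def by (intro borel_measurable_continuous_onI continuous_intros)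

lemma coord_vec_of_coords: "i < k \<Longrightarrow> coord (vec_of_coords k x) i = x i"
proof -
  assume i: "i < k"
  have "coord (vec_of_coords k x) i = (\<Sum>a<k. if a = i then x a else 0)"
    unfolding coord_sum by (intro sum.cong) auto
  then show ?thesis
    using i by simp
qed

lemma distr_lebesgue_eucl_shear:
  assumes ij: "i < k" "j < k" "i \<noteq> j"
  shows "distr (lebesgue_eucl k) borel (shear i j c) = lebesgue_eucl k"
proof -
  let ?S = "\<lambda>x::nat \<Rightarrow> real. x(i := x i + c * x j)"
  have S[measurable]: "?S \<in> measurable (lborel_pow k) (lborel_pow k)"
    by (rule measurable_fun_upd[where J = "{..<k}"]) (use ij in \<open>auto intro!: measurable_component_singleton borel_measurable_add borel_measurable_times measurable_ident_sets\<close>)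
  have "vec_of_coords k (?S x) = shear i j c (vec_of_coords k x)" for x
  proof (rule fseq_eqI)
    show "coord (vec_of_coords k (?S x)) l = coord (shear i j c (vec_of_coords k x)) l" for l
    proof (cases "l < k")
      case True
      then show ?thesis
        using ij by (simp add: shear_def coord_vec_of_coords)
    next
      case False
      have "coord (vec_of_coords k z) l = 0" for z
        using False by (simp add: coord_sum)
      then show ?thesis
        using ij False by (simp add: shear_def)
    qed
  qed
  then have "distr (lebesgue_eucl k) borel (shear i j c) =
      distr (lborel_pow k) borel (vec_of_coords k \<circ> ?S)"
    unfolding lebesgue_eucl_def by (subst distr_distr) (auto simp: o_def)
  also have "\<dots> = distr (distr (lborel_pow k) (lborel_pow k) ?S) borel (vec_of_coords k)"
    by (subst distr_distr) auto
  finally show ?thesis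
    unfolding distr_lborel_pow_shear[OF ij] lebesgue_eucl_def .
qed

definition rotation :: "nat \<Rightarrow> nat \<Rightarrow> real \<Rightarrow> fseq \<Rightarrow> fseq"
  where "rotation i j t x =
    x + ((cos t - 1) * coord x i - sin t * coord x j) *\<^sub>R unit_vec i +
      (sin t * coord x i + (cos t - 1) * coord x j) *\<^sub>R unit_vec j"

text \<open>The shear coefficient is \<open>- tan (t / 2)\<close>.\<close>

lemma rotation_eq_shears:
  assumes "i \<noteq> j" "cos t \<noteq> - 1"
  defines "a \<equiv> - sin t / (1 + cos t)"
  shows "rotation i j t x = shear i j a (shear j i (sin t) (shear i j a x))"
proof (rule fseq_eqI)
  have c: "1 + cos t \<noteq> 0"
    using assms(2) by linarith
  have "sin t * sin t = (1 + cos t) * (1 - cos t)"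
    using sin_cos_squared_add[of t] by (simp add: algebra_simps power2_eq_square)
  then have 1: "sin t * a = cos t - 1"
    using c by (simp add: a_def field_simps)
  have 2: "a * cos t = - sin t - a"
    using c by (simp add: a_def field_simps)
  have "x1 + a * x2 + a * (x2 + sin t * (x1 + a * x2)) =
      x1 + ((cos t - 1) * x1 - sin t * x2)" for x1 x2
  proof -
    have "x1 + a * x2 + a * (x2 + sin t * (x1 + a * x2))
        = 2 * a * x2 + (sin t * a) * x1 + (sin t * a) * a * x2 + x1"
      by (simp add: algebra_simps)
    also have "\<dots> = (a + a * cos t) * x2 + cos t * x1"
      unfolding 1 by (simp add: algebra_simps)
    finally show ?thesis
      by (simp add: 2 algebra_simps)
  qed
  moreover have "x2 + sin t * (x1 + a * x2) = x2 + (sin t * x1 + (cos t - 1) * x2)" for x1 x2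
    unfolding 1[symmetric] by (simp add: algebra_simps)
  ultimately show "coord (rotation i j t x) l =
      coord (shear i j a (shear j i (sin t) (shear i j a x))) l" for l
    using assms(1) by (cases "l = i"; cases "l = j") (simp_all add: rotation_def shear_def)
qed

lemma continuous_on_rotation: "continuous_on A (rotation i j t)"
  unfolding rotation_def by (intro continuous_intros)

lemma measurable_rotation [measurable]: "rotation i j t \<in> borel_measurable borel"
  by (intro borel_measurable_continuous_onI continuous_on_rotation)

text \<open>Half turns are excluded because \<open>tan (t / 2)\<close>, which enters the shear
  decomposition, has a pole there.\<close>

lemma distr_lebesgue_eucl_rotation:
  assumes ij: "i < k" "j < k" "i \<noteq> j" and t: "cos t \<noteq> - 1"
  shows "distr (lebesgue_eucl k) borel (rotation i j t) = lebesgue_eucl k"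
proof -
  define a where "a = - sin t / (1 + cos t)"
  note shear = distr_lebesgue_eucl_shear[OF ij, of a]
  have [measurable_cong]: "sets (lebesgue_eucl k) = sets borel"
    by (simp add: lebesgue_eucl_def)
  have "rotation i j t = shear i j a \<circ> (shear j i (sin t) \<circ> shear i j a)"
    using rotation_eq_shears[OF ij(3) t] by (simp add: fun_eq_iff a_def)
  then have "distr (lebesgue_eucl k) borel (rotation i j t) =
      distr (distr (distr (lebesgue_eucl k) borel (shear i j a)) borel (shear j i (sin t)))
        borel (shear i j a)"
    by (simp add: distr_distr comp_assoc)
  then show ?thesis
    using ij by (simp add: shear distr_lebesgue_eucl_shear)
qed

lemma linear_rotation: "linear (rotation i j t)"
  by (auto intro!: linearI fseq_eqI simp: rotation_def algebra_simps)

lemma norm_rotation: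
  assumes "i \<noteq> j"
  shows "norm (rotation i j t x) = norm x"
proof -
  let ?a = "(cos t - 1) * coord x i - sin t * coord x j"
  let ?b = "sin t * coord x i + (cos t - 1) * coord x j"
  have "(x + a *\<^sub>R unit_vec i + b *\<^sub>R unit_vec j) \<bullet> (x + a *\<^sub>R unit_vec i + b *\<^sub>R unit_vec j) =
      x \<bullet> x + 2 * (a * coord x i) + 2 * (b * coord x j) + a * a + b * b" for a b
    using assms by (simp add: inner_add_left inner_add_right inner_unit_vec
        inner_commute[of "unit_vec _" x] algebra_simps)
  then have "rotation i j t x \<bullet> rotation i j t x =
      x \<bullet> x + 2 * (?a * coord x i) + 2 * (?b * coord x j) + ?a * ?a + ?b * ?b"
    unfolding rotation_def .
  \<comment> \<open>The change of the squared norm is a multiple of \<open>q^2 + p^2 - 1\<close>,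
    which vanishes for sine and cosine.\<close>
  moreover have "r + 2 * (((p - 1) * x1 - q * x2) * x1) + 2 * ((q * x1 + (p - 1) * x2) * x2)
      + ((p - 1) * x1 - q * x2) * ((p - 1) * x1 - q * x2)
      + (q * x1 + (p - 1) * x2) * (q * x1 + (p - 1) * x2)
      = r + (q\<^sup>2 + p\<^sup>2 - 1) * (x1 * x1 + x2 * x2)" for p q r x1 x2 :: real
    by (simp add: algebra_simps power2_eq_square)
  ultimately have "rotation i j t x \<bullet> rotation i j t x =
      x \<bullet> x + ((sin t)\<^sup>2 + (cos t)\<^sup>2 - 1) * (coord x i * coord x i + coord x j * coord x j)"
    by (simp only:)
  then show ?thesis
    by (simp add: norm_eq_sqrt_inner)
qed

lemma rotation_in_eucl:
  assumes "i < k" "j < k"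
  shows "rotation i j t x \<in> eucl k \<longleftrightarrow> x \<in> eucl k"
proof -
  have "coord (rotation i j t x) l = coord x l" if "l \<ge> k" for l
    using that assms by (simp add: rotation_def)
  then show ?thesis
    by (simp add: eucl_def)
qed

lemma rotation_in_rsphere:
  "i \<le> n \<Longrightarrow> j \<le> n \<Longrightarrow> i \<noteq> j \<Longrightarrow> rotation i j t x \<in> rsphere n \<longleftrightarrow> x \<in> rsphere n"
  by (simp add: rsphere_def norm_rotation rotation_in_eucl)

section \<open>The cone measure: finiteness, integrability, invariance\<close>

abbreviation punctured_ball :: "nat \<Rightarrow> fseq set"
  where "punctured_ball n \<equiv> cball 0 1 \<inter> eucl (Suc n) - {0}"

lemma sets_sphere_measure [measurable_cong]:
  "sets (sphere_measure n) = sets (restrict_space borel (rsphere n))"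
  by (simp add: sphere_measure_def)

lemma space_sphere_measure [simp]: "space (sphere_measure n) = rsphere n"
  by (simp add: sphere_measure_def space_restrict_space space_scale_measure)

lemma sets_punctured_ball: "punctured_ball n \<in> sets borel"
  by (intro sets.Diff sets.Int borel_closed closed_cball closed_eucl closed_singleton)

lemma sgn_in_rsphere: "x \<in> punctured_ball n \<Longrightarrow> sgn x \<in> rsphere n"
  by (auto simp: rsphere_def norm_sgn sgn_div_norm eucl_closed_ops)

text \<open>Reduces the sphere measure to Lebesgue measure of the cone over \<open>A\<close> with
  its apex removed, which is the form in which invariance and finiteness are inherited.\<close>

lemma emeasure_sphere_measure:
  assumes "A \<in> sets (sphere_measure n)"
  shows "{x \<in> punctured_ball n. sgn x \<in> A} \<in> sets borel"
    and "emeasure (sphere_measure n) A =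
      of_nat (Suc n) * emeasure (lebesgue_eucl (Suc n)) {x \<in> punctured_ball n. sgn x \<in> A}"
proof -
  let ?L = "lebesgue_eucl (Suc n)" and ?D = "punctured_ball n"
  have L: "sets ?L = sets borel" "space ?L = UNIV"
    by (simp_all add: lebesgue_eucl_def)
  have sp: "space (restrict_space ?L ?D) = ?D"
    by (simp add: space_restrict_space L)
  have "continuous_on ?D sgn"
    unfolding sgn_div_norm by (intro continuous_intros) auto
  then have "sgn \<in> borel_measurable (restrict_space borel ?D)"
    by (rule borel_measurable_continuous_on_restrict)
  then have "sgn \<in> borel_measurable (restrict_space ?L ?D)"
    by (subst measurable_cong_sets[OF sets_restrict_space_cong[OF L(1)] refl])
  then have sgn: "sgn \<in> measurable (restrict_space ?L ?D) (restrict_space borel (rsphere n))"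
    by (intro measurable_restrict_space2) (use sgn_in_rsphere sp in auto)
  have A: "A \<in> sets (restrict_space borel (rsphere n))"
    using assms by (simp add: sphere_measure_def)
  have eq: "sgn -` A \<inter> space (restrict_space ?L ?D) = {x \<in> ?D. sgn x \<in> A}"
    unfolding sp by auto
  have "sgn -` A \<inter> space (restrict_space ?L ?D) \<in> sets (restrict_space ?L ?D)"
    using sgn A by (rule measurable_sets)
  then show "{x \<in> ?D. sgn x \<in> A} \<in> sets borel"
    unfolding eq using sets_punctured_ball by (subst (asm) sets_restrict_space_iff) (auto simp: L)
  show "emeasure (sphere_measure n) A = of_nat (Suc n) * emeasure ?L {x \<in> ?D. sgn x \<in> A}"
    unfolding sphere_measure_def emeasure_scale_measure emeasure_distr[OF sgn A] eq
    using sets_punctured_ball by (subst emeasure_restrict_space) (auto simp: L)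
qed

text \<open>The punctured ball lies in the cube with sides \<open>{- 1..1}\<close>, of volume
  \<open>2 ^ (n + 1)\<close>.\<close>

lemma finite_measure_sphere_measure: "finite_measure (sphere_measure n)"
proof (rule finite_measureI)
  let ?k = "Suc n" and ?D = "punctured_ball n"
  let ?B = "\<Pi>\<^sub>E i\<in>{..<?k}. {- 1..1::real}"
  have D: "{x \<in> ?D. sgn x \<in> rsphere n} = ?D"
    using sgn_in_rsphere by auto
  have "rsphere n \<in> sets (sphere_measure n)"
    using sets.top[of "sphere_measure n"] by simp
  note em = emeasure_sphere_measure(2)[OF this, unfolded D]
  have "emeasure (lebesgue_eucl ?k) ?D = emeasure (lborel_pow ?k) (vec_of_coords ?k -` ?D \<inter> space (lborel_pow ?k))"
    unfolding lebesgue_eucl_def by (rule emeasure_distr[OF measurable_vec_of_coords sets_punctured_ball])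
  also have "\<dots> \<le> emeasure (lborel_pow ?k) ?B"
  proof (rule emeasure_mono)
    show "vec_of_coords ?k -` ?D \<inter> space (lborel_pow ?k) \<subseteq> ?B"
    proof
      fix x assume x: "x \<in> vec_of_coords ?k -` ?D \<inter> space (lborel_pow ?k)"
      have "\<bar>x i\<bar> \<le> 1" if "i < ?k" for i
        using Cauchy_Schwarz_ineq2[of "vec_of_coords ?k x" "unit_vec i"] x that
        by (simp add: inner_unit_vec coord_vec_of_coords del: sum.lessThan_Suc)
      then show "x \<in> ?B"
        using x by (auto simp: space_PiM PiE_iff abs_le_iff)
    qed
    show "?B \<in> sets (lborel_pow ?k)"
      by (intro sets_PiM_I_finite) auto
  qed
  also have "emeasure (lborel_pow ?k) ?B = (\<Prod>i\<in>{..<?k}. emeasure lborel {- 1..1::real})"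
    by (rule lborel_product.emeasure_PiM) auto
  also have "\<dots> = (\<Prod>i\<in>{..<?k}. ennreal 2)"
    by (intro prod.cong) auto
  also have "\<dots> = ennreal (\<Prod>i\<in>{..<?k}. 2)"
    by (rule prod_ennreal) simp
  also have "\<dots> < \<infinity>"
    by simp
  finally have "emeasure (lebesgue_eucl ?k) ?D < \<infinity>" .
  then show "emeasure (sphere_measure n) (space (sphere_measure n)) \<noteq> \<infinity>"
    by (simp add: em ennreal_mult_eq_top_iff)
qed

lemma measurable_sphere_measure:
  "continuous_on (rsphere n) (f :: fseq \<Rightarrow> real) \<Longrightarrow> f \<in> borel_measurable (sphere_measure n)"
  by (subst measurable_cong_sets[OF sets_sphere_measure refl])
    (rule borel_measurable_continuous_on_restrict)

lemma integrable_sphere_measure: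
  assumes f: "continuous_on (rsphere n) (f :: fseq \<Rightarrow> real)"
  shows "integrable (sphere_measure n) f"
proof -
  obtain B where "\<And>x. x \<in> rsphere n \<Longrightarrow> norm (f x) \<le> B"
    using compact_continuous_image[OF f compact_rsphere, THEN compact_imp_bounded]
    by (auto simp: bounded_iff)
  then show ?thesis
    by (intro finite_measure.integrable_const_bound[OF finite_measure_sphere_measure, of _ B]
        measurable_sphere_measure f AE_I2) auto
qed

text \<open>Rotations are linear isometries, so they commute with \<open>sgn\<close> and preserve
  the punctured ball. Hence the cone over the preimage of \<open>A\<close> is the preimage of the
  cone over \<open>A\<close>.\<close>

lemma distr_sphere_measure_rotation:
  assumes ij: "i \<le> n" "j \<le> n" "i \<noteq> j" and t: "cos t \<noteq> - 1"
  shows "rotation i j t \<in> measurable (sphere_measure n) (sphere_measure n)"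
    and "distr (sphere_measure n) (sphere_measure n) (rotation i j t) = sphere_measure n"
proof -
  let ?R = "rotation i j t" and ?D = "punctured_ball n"
  have "?R \<in> borel_measurable (restrict_space borel (rsphere n))"
    by (intro borel_measurable_continuous_on_restrict continuous_on_rotation)
  then have "?R \<in> measurable (restrict_space borel (rsphere n)) (restrict_space borel (rsphere n))"
    by (intro measurable_restrict_space2)
      (auto simp: space_restrict_space rotation_in_rsphere ij)
  then show R: "?R \<in> measurable (sphere_measure n) (sphere_measure n)"
    by (subst measurable_cong_sets[OF sets_sphere_measure sets_sphere_measure])
  have RD: "?R x \<in> ?D \<longleftrightarrow> x \<in> ?D" for x
  proof -
    have "?R x = 0 \<longleftrightarrow> x = 0"
      using norm_rotation[OF ij(3), of t x] by (metis norm_eq_zero)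
    then show ?thesis
      using ij by (simp add: norm_rotation rotation_in_eucl)
  qed
  have sgn: "sgn (?R x) = ?R (sgn x)" for x
    by (simp only: sgn_div_norm norm_rotation[OF ij(3)] linear_scale[OF linear_rotation])
  show "distr (sphere_measure n) (sphere_measure n) ?R = sphere_measure n"
  proof (rule measure_eqI)
    fix A assume "A \<in> sets (distr (sphere_measure n) (sphere_measure n) ?R)"
    then have A: "A \<in> sets (sphere_measure n)"
      by simp
    let ?B = "{x \<in> ?D. sgn x \<in> A}"
    have RA: "?R -` A \<inter> space (sphere_measure n) \<in> sets (sphere_measure n)"
      using R A by (rule measurable_sets)
    have B: "{x \<in> ?D. sgn x \<in> ?R -` A \<inter> space (sphere_measure n)} = ?R -` ?B \<inter> space (lebesgue_eucl (Suc n))"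
      using sgn_in_rsphere RD sgn by (auto simp: lebesgue_eucl_def)
    have "emeasure (distr (sphere_measure n) (sphere_measure n) ?R) A =
        of_nat (Suc n) * emeasure (lebesgue_eucl (Suc n)) (?R -` ?B \<inter> space (lebesgue_eucl (Suc n)))"
      by (simp only: emeasure_distr[OF R A] emeasure_sphere_measure(2)[OF RA] B)
    also have "\<dots> = of_nat (Suc n) * emeasure (distr (lebesgue_eucl (Suc n)) borel ?R) ?B"
      using emeasure_sphere_measure(1)[OF A]
      by (subst emeasure_distr) (auto simp: lebesgue_eucl_def)
    also have "\<dots> = emeasure (sphere_measure n) A"
      using ij t by (subst distr_lebesgue_eucl_rotation) (auto simp: emeasure_sphere_measure(2)[OF A])
    finally show "emeasure (distr (sphere_measure n) (sphere_measure n) ?R) A = emeasure (sphere_measure n) A" .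
  qed simp
qed

lemma integral_sphere_measure_rotation:
  assumes "i \<le> n" "j \<le> n" "i \<noteq> j" "cos t \<noteq> - 1" "continuous_on (rsphere n) (f :: fseq \<Rightarrow> real)"
  shows "(\<integral>x. f (rotation i j t x) \<partial>sphere_measure n) = (\<integral>x. f x \<partial>sphere_measure n)"
  using integral_distr[OF distr_sphere_measure_rotation(1)[OF assms(1-4)]
      measurable_sphere_measure[OF assms(5)]]
  by (simp add: distr_sphere_measure_rotation(2)[OF assms(1-4)])

section \<open>Divergence and the first variation\<close>

text \<open>The mean value theorem bounds all difference quotients by \<open>B\<close>, a constant
  that is integrable over a finite measure space, and dominated convergence applies along every
  sequence tending to 0.\<close>

lemma (in finite_measure) has_real_derivative_integral:
  fixes f f' :: "real \<Rightarrow> 'a \<Rightarrow> real"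
  assumes d: "d > 0"
    and int: "\<And>t. \<bar>t\<bar> < d \<Longrightarrow> integrable M (f t)"
    and deriv: "\<And>t x. \<bar>t\<bar> < d \<Longrightarrow> x \<in> space M \<Longrightarrow> ((\<lambda>s. f s x) has_real_derivative f' t x) (at t)"
    and bound: "\<And>t x. \<bar>t\<bar> < d \<Longrightarrow> x \<in> space M \<Longrightarrow> \<bar>f' t x\<bar> \<le> B"
    and meas: "f' 0 \<in> borel_measurable M"
  shows "((\<lambda>t. \<integral>x. f t x \<partial>M) has_real_derivative (\<integral>x. f' 0 x \<partial>M)) (at 0)"
  unfolding has_field_derivative_iff tendsto_at_iff_sequentially
proof (intro allI impI)
  fix X :: "nat \<Rightarrow> real"
  assume X: "\<forall>i. X i \<in> UNIV - {0}" "X \<longlonglongrightarrow> 0"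
  have "\<forall>\<^sub>F i in sequentially. \<bar>X i\<bar> < d"
    using tendstoD[OF X(2) d] by simp
  then obtain N where N: "\<And>i. i \<ge> N \<Longrightarrow> \<bar>X i\<bar> < d"
    by (auto simp: eventually_sequentially)
  \<comment> \<open>Dropping the first \<open>N\<close> terms puts every member of the sequence into
    the interval where the hypotheses hold.\<close>
  define Y where "Y i = X (i + N)" for i
  have Y: "\<bar>Y i\<bar> < d" "Y i \<noteq> 0" for i
    using N X(1) by (auto simp: Y_def)
  have Y0: "Y \<longlonglongrightarrow> 0"
    using LIMSEQ_ignore_initial_segment[OF X(2)] by (simp add: Y_def[abs_def])
  let ?q = "\<lambda>i x. (f (Y i) x - f 0 x) / Y i"
  have "(\<lambda>i. \<integral>x. ?q i x \<partial>M) \<longlonglongrightarrow> (\<integral>x. f' 0 x \<partial>M)"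
  proof (rule integral_dominated_convergence[where w = "\<lambda>_. B"])
    show "?q i \<in> borel_measurable M" for i
      using int[OF Y(1)] int[of 0] d by (auto intro!: borel_measurable_divide borel_measurable_diff)
    show "AE x in M. (\<lambda>i. ?q i x) \<longlonglongrightarrow> f' 0 x"
    proof (rule AE_I2)
      fix x assume "x \<in> space M"
      then have "((\<lambda>t. (f t x - f 0 x) / (t - 0)) \<longlongrightarrow> f' 0 x) (at 0)"
        using deriv[of 0 x] d by (simp add: has_field_derivative_iff)
      then show "(\<lambda>i. ?q i x) \<longlonglongrightarrow> f' 0 x"
        using Y(2) Y0 by (simp add: tendsto_at_iff_sequentially o_def)
    qed
    show "AE x in M. norm (?q i x) \<le> B" for i
    proof (rule AE_I2)
      fix x assume x: "x \<in> space M"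
      have "norm (f (Y i) x - f 0 x) \<le> B * norm (Y i - 0)"
      proof (rule field_differentiable_bound[of "{- d<..<d}"])
        show "((\<lambda>s. f s x) has_real_derivative f' t x) (at t within {- d<..<d})"
          if "t \<in> {- d<..<d}" for t
          using deriv[of t x] x that by (auto intro: has_field_derivative_at_within simp: abs_less_iff)
        show "norm (f' t x) \<le> B" if "t \<in> {- d<..<d}" for t
          using bound[of t x] x that by (auto simp: abs_less_iff)
      qed (use Y(1)[of i] d in \<open>auto simp: abs_less_iff\<close>)
      then show "norm (?q i x) \<le> B"
        using Y(2)[of i] by (simp add: field_simps)
    qed
  qed (use meas in auto)
  moreover have "(\<integral>x. ?q i x \<partial>M) = ((\<integral>x. f (Y i) x \<partial>M) - (\<integral>x. f 0 x \<partial>M)) / (Y i - 0)" for i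
    using int[OF Y(1)] int[of 0] d by (simp add: Bochner_Integration.integral_diff)
  ultimately have "(\<lambda>i. ((\<lambda>t. ((\<integral>x. f t x \<partial>M) - (\<integral>x. f 0 x \<partial>M)) / (t - 0)) \<circ> X) (i + N))
      \<longlonglongrightarrow> (\<integral>x. f' 0 x \<partial>M)"
    unfolding o_def Y_def[symmetric] by (simp only:)
  then show "((\<lambda>t. ((\<integral>x. f t x \<partial>M) - (\<integral>x. f 0 x \<partial>M)) / (t - 0)) \<circ> X) \<longlonglongrightarrow> (\<integral>x. f' 0 x \<partial>M)"
    by (rule LIMSEQ_offset)
qed

text \<open>The velocity is the rotation field evaluated at the current point, at every
  \<open>t\<close> and not just at 0. This gives the derivative of a function along the orbit at all
  nearby times, as differentiation under the integral requires.\<close>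

lemma has_vector_derivative_rotation:
  assumes "i \<noteq> j"
  shows "((\<lambda>t. rotation i j t x) has_vector_derivative
    (coord (rotation i j t x) i *\<^sub>R unit_vec j - coord (rotation i j t x) j *\<^sub>R unit_vec i)) (at t)"
proof -
  have scale: "((\<lambda>t. f t *\<^sub>R v) has_vector_derivative f' *\<^sub>R v) (at t)"
    if "(f has_real_derivative f') (at t)" for f f' and v :: fseq
    using bounded_linear.has_vector_derivative[OF bounded_linear_scaleR_left] that
    by (simp add: has_real_derivative_iff_has_vector_derivative)
  have "((\<lambda>t. rotation i j t x) has_vector_derivative
      (0 + ((- sin t - 0) * coord x i - cos t * coord x j) *\<^sub>R unit_vec i +
        (cos t * coord x i + (- sin t - 0) * coord x j) *\<^sub>R unit_vec j)) (at t)"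
    unfolding rotation_def
    by (intro has_vector_derivative_add has_vector_derivative_const scale
        DERIV_add DERIV_diff DERIV_cmult_right DERIV_sin DERIV_cos DERIV_const)
  moreover have "0 + ((- sin t - 0) * coord x i - cos t * coord x j) *\<^sub>R unit_vec i +
        (cos t * coord x i + (- sin t - 0) * coord x j) *\<^sub>R unit_vec j =
      coord (rotation i j t x) i *\<^sub>R unit_vec j - coord (rotation i j t x) j *\<^sub>R unit_vec i"
    by (rule fseq_eqI) (use assms in \<open>simp add: rotation_def algebra_simps\<close>)
  ultimately show ?thesis
    by simp
qed

lemma rotation_0 [simp]: "rotation i j 0 x = x"
  by (simp add: rotation_def)

text \<open>The integrand is the derivative at angle 0 of \<open>coord x i * coord (V x) j\<close>
  along the rotation. The integral of the rotated function is constant in the angle, so its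
  derivative vanishes.\<close>

lemma integral_rotation_derivative_eq_0:
  assumes ij: "i \<le> n" "j \<le> n" "i \<noteq> j"
    and V: "\<And>x. x \<in> rsphere n \<Longrightarrow> V differentiable (at x within rsphere n)"
    and cont: "\<And>v. v \<in> eucl (Suc n) \<Longrightarrow> continuous_on (rsphere n) (\<lambda>x. sdiff n V x v)"
  shows "(\<integral>x. - (coord x j * coord (V x) j) + coord x i *
    (coord x i * coord (sdiff n V x (unit_vec j)) j - coord x j * coord (sdiff n V x (unit_vec i)) j)
    \<partial>sphere_measure n) = 0"
proof -
  let ?R = "rotation i j"
  let ?h = "\<lambda>x. - (coord x j * coord (V x) j) + coord x i *
    (coord x i * coord (sdiff n V x (unit_vec j)) j - coord x j * coord (sdiff n V x (unit_vec i)) j)"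
  let ?g = "\<lambda>x. coord x i * coord (V x) j"
  have R: "?R t x \<in> rsphere n" if "x \<in> rsphere n" for t x
    using that ij by (simp add: rotation_in_rsphere)
  have contV: "continuous_on (rsphere n) V"
    by (rule continuous_on_rsphere[OF V])
  have conth: "continuous_on (rsphere n) ?h"
    using ij by (intro continuous_intros contV cont bounded_linear.continuous_on[OF bounded_linear_coord]) auto
  have contg: "continuous_on (rsphere n) ?g"
    by (intro continuous_intros contV bounded_linear.continuous_on[OF bounded_linear_coord])
  obtain B where B: "\<And>x. x \<in> rsphere n \<Longrightarrow> \<bar>?h x\<bar> \<le> B"
    using compact_continuous_image[OF conth compact_rsphere, THEN compact_imp_bounded]
    by (auto simp: bounded_iff)
  have deriv: "((\<lambda>t. ?g (?R t x)) has_real_derivative ?h (?R t x)) (at t)"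
    if x: "x \<in> rsphere n" for t x
  proof -
    let ?y = "?R t x"
    let ?v = "coord ?y i *\<^sub>R unit_vec j - coord ?y j *\<^sub>R unit_vec i"
    note y' = has_vector_derivative_rotation[OF ij(3), of x t]
    have "((\<lambda>t. V (?R t x)) has_vector_derivative sdiff n V ?y ?v) (at t)"
      using sdiff_has_vector_derivative[of V "\<lambda>t. ?R t x" t n] V R[OF x] y' by blast
    from has_vector_derivative_coord[OF this, of j]
    have 1: "((\<lambda>t. coord (V (?R t x)) j) has_real_derivative coord (sdiff n V ?y ?v) j) (at t)"
      by (simp add: has_real_derivative_iff_has_vector_derivative)
    have lin: "linear (sdiff n V ?y)"
      by (rule linear_sdiff[OF V[OF R[OF x]]])
    have sd: "coord (sdiff n V ?y ?v) j = coord ?y i * coord (sdiff n V ?y (unit_vec j)) j -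
        coord ?y j * coord (sdiff n V ?y (unit_vec i)) j"
      by (simp add: linear_diff[OF lin] linear_scale[OF lin])
    have 2: "((\<lambda>t. coord (?R t x) i) has_real_derivative (- coord ?y j)) (at t)"
      using has_vector_derivative_coord[OF y', of i] ij(3)
      by (simp add: has_real_derivative_iff_has_vector_derivative)
    show ?thesis
      using DERIV_mult[OF 2 1] by (simp add: sd algebra_simps)
  qed
  have "((\<lambda>t. \<integral>x. ?g (?R t x) \<partial>sphere_measure n) has_real_derivative (\<integral>x. ?h (?R 0 x) \<partial>sphere_measure n)) (at 0)"
  proof (rule finite_measure.has_real_derivative_integral[OF finite_measure_sphere_measure, of 1 _ _ _ B])
    fix t :: real
    have "continuous_on (rsphere n) (\<lambda>x. ?g (?R t x))"
      using R by (intro continuous_on_compose2[OF contg continuous_on_rotation]) auto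
    then show "integrable (sphere_measure n) (\<lambda>x. ?g (?R t x))"
      by (rule integrable_sphere_measure)
  qed (use deriv B R measurable_sphere_measure[OF conth] in auto)
  moreover have "((\<lambda>t. \<integral>x. ?g (?R t x) \<partial>sphere_measure n) has_real_derivative 0) (at 0)"
  \<comment> \<open>On this interval \<open>cos t > 0\<close>, so no half turn occurs.\<close>
  proof (rule has_field_derivative_transform_within_open[OF DERIV_const, where S = "{- 1<..<1}"])
    fix t :: real assume t: "t \<in> {- 1<..<1}"
    have "cos t > 0"
      using t pi_gt3 by (intro cos_gt_zero_pi) auto
    then show "(\<integral>x. ?g x \<partial>sphere_measure n) = (\<integral>x. ?g (?R t x) \<partial>sphere_measure n)"
      by (intro integral_sphere_measure_rotation[OF ij _ contg, symmetric]) simp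
  qed auto
  ultimately show ?thesis
    using DERIV_unique by fastforce
qed

text \<open>
  The tangent vector \<open>unit_vec j - x\<^sub>j *\<^sub>R x\<close> is the combination with coefficients \<open>x\<^sub>i\<close> of the rotation
  fields \<open>x\<^sub>i *\<^sub>R unit_vec j - x\<^sub>j *\<^sub>R unit_vec i\<close>, so the divergence of \<open>V\<close> is a sum of derivatives of
  the functions \<open>x\<^sub>i * V\<^sub>j\<close> along rotations, up to a multiple of \<open>x \<bullet> V x\<close>.
\<close>

lemma sphere_divergence:
  assumes V: "\<And>x. x \<in> rsphere n \<Longrightarrow> V differentiable (at x within rsphere n)"
    and cont: "\<And>v. v \<in> eucl (Suc n) \<Longrightarrow> continuous_on (rsphere n) (\<lambda>x. sdiff n V x v)"
    and tangent: "\<And>x. x \<in> rsphere n \<Longrightarrow> x \<bullet> V x = 0"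
  shows "(\<integral>x. (\<Sum>i\<le>n. coord (sdiff n V x (unit_vec i)) i) \<partial>sphere_measure n) = 0"
proof -
  let ?a = "\<lambda>x i j. coord (sdiff n V x (unit_vec i)) j"
  let ?h = "\<lambda>i j x. - (coord x j * coord (V x) j) + coord x i * (coord x i * ?a x j j - coord x j * ?a x i j)"
  have contV: "continuous_on (rsphere n) V"
    by (rule continuous_on_rsphere[OF V])
  have int: "integrable (sphere_measure n) (?h i j)" if "i \<le> n" "j \<le> n" for i j
    using that by (intro integrable_sphere_measure continuous_intros contV cont
        bounded_linear.continuous_on[OF bounded_linear_coord]) auto
  have tangent': "(\<Sum>j\<le>n. coord x j * coord (V x) j) = 0" if "x \<in> rsphere n" for x
    using tangent[OF that] that inner_eucl[of x "Suc n" "V x"] by (simp add: rsphere_iff lessThan_Suc_atMost)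
  have eq: "(\<Sum>i\<le>n. ?a x i i) = (\<Sum>i\<le>n. \<Sum>j\<le>n. ?h i j x)" if x: "x \<in> rsphere n" for x
  proof -
    have zero: "(\<Sum>i\<le>n. coord x i * ?a x i j) = 0" for j
      using coord_sum[of "\<lambda>i. coord x i *\<^sub>R sdiff n V x (unit_vec i)" "{..n}" j]
      by (simp add: sum_coord_sdiff[OF V[OF x] x])
    have "(\<Sum>i\<le>n. \<Sum>j\<le>n. ?h i j x) =
        (\<Sum>i\<le>n. - (\<Sum>j\<le>n. coord x j * coord (V x) j)) + (\<Sum>i\<le>n. \<Sum>j\<le>n. coord x i * coord x i * ?a x j j)
        - (\<Sum>i\<le>n. \<Sum>j\<le>n. coord x j * (coord x i * ?a x i j))"
      by (simp add: sum.distrib sum_subtractf sum_negf algebra_simps)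
    also have "(\<Sum>i\<le>n. \<Sum>j\<le>n. coord x j * (coord x i * ?a x i j)) = (\<Sum>j\<le>n. coord x j * (\<Sum>i\<le>n. coord x i * ?a x i j))"
      by (subst sum.swap) (simp add: sum_distrib_left)
    also have "(\<Sum>i\<le>n. \<Sum>j\<le>n. coord x i * coord x i * ?a x j j) = (\<Sum>i\<le>n. coord x i * coord x i) * (\<Sum>j\<le>n. ?a x j j)"
      by (simp add: sum_product)
    finally show ?thesis
      using rsphere_coord_sum[OF x] tangent'[OF x] by (simp add: zero)
  qed
  have "(\<integral>x. (\<Sum>i\<le>n. ?a x i i) \<partial>sphere_measure n) = (\<integral>x. (\<Sum>i\<le>n. \<Sum>j\<le>n. ?h i j x) \<partial>sphere_measure n)"
    by (rule Bochner_Integration.integral_cong) (simp_all only: space_sphere_measure eq)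
  also have "\<dots> = (\<Sum>i\<le>n. \<Sum>j\<le>n. \<integral>x. ?h i j x \<partial>sphere_measure n)"
    using int by (subst Bochner_Integration.integral_sum; (intro Bochner_Integration.integrable_sum)?;
        (intro sum.cong refl Bochner_Integration.integral_sum)?; simp)
  \<comment> \<open>Off the diagonal the rotation lemma gives 0. On the diagonal the bracket in
    \<open>?h i i\<close> cancels and \<open>- (coord x i * coord (V x) i)\<close> remains, which
    sums to \<open>- (x \<bullet> V x) = 0\<close>.\<close>
  also have "\<dots> = (\<Sum>i\<le>n. \<integral>x. ?h i i x \<partial>sphere_measure n)"
  proof (rule sum.cong[OF refl])
    fix i assume "i \<in> {..n}"
    then have "(\<Sum>j\<le>n. \<integral>x. ?h i j x \<partial>sphere_measure n) =
        (\<Sum>j\<le>n. if j = i then \<integral>x. ?h i i x \<partial>sphere_measure n else 0)"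
      using integral_rotation_derivative_eq_0[OF _ _ _ V cont] by (intro sum.cong) auto
    with \<open>i \<in> {..n}\<close> show "(\<Sum>j\<le>n. \<integral>x. ?h i j x \<partial>sphere_measure n) = (\<integral>x. ?h i i x \<partial>sphere_measure n)"
      by simp
  qed
  also have "\<dots> = (\<integral>x. (\<Sum>i\<le>n. ?h i i x) \<partial>sphere_measure n)"
    by (intro Bochner_Integration.integral_sum[symmetric] int) auto
  also have "\<dots> = (\<integral>x. 0 \<partial>sphere_measure n)"
    by (rule Bochner_Integration.integral_cong) (use tangent' in \<open>simp_all add: sum_negf\<close>)
  finally show ?thesis
    by simp
qed

section \<open>The first variation of the energy at the equator\<close>

lemma n_harmonic_equator:
  assumes n: "even n" "n > 0" and c: "c > 0"
  shows "n_harmonic n (rsphere (Suc n), \<lambda>p v w. c * (v \<bullet> w)) (\<lambda>x. x)"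
  unfolding n_harmonic_def fst_conv snd_conv
proof (intro allI impI)
  fix F assume F: "outer_variation n (rsphere (Suc n)) (\<lambda>x. x) F"
  let ?S = "rsphere n"
  obtain m where m: "n = 2 * m"
    using n by auto
  obtain \<delta> F' where \<delta>: "\<delta> > 0" and var: "(\<forall>t\<in>{-\<delta><..<\<delta>}. \<forall>x\<in>?S. F t x \<in> rsphere (Suc n)) \<and>
      C1_family n {-\<delta><..<\<delta>} F \<and> C1_family n {-\<delta><..<\<delta>} F' \<and>
      (\<forall>t\<in>{-\<delta><..<\<delta>}. \<forall>x\<in>?S. ((\<lambda>s. F s x) has_vector_derivative F' t x) (at t) \<and>
        (\<forall>v\<in>eucl (Suc n). ((\<lambda>s. sdiff n (F s) x v) has_vector_derivative sdiff n (F' t) x v) (at t)))"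
    using F[unfolded outer_variation_def, THEN conjunct2] by blast
  have F_in: "F t x \<in> rsphere (Suc n)"
    and F': "((\<lambda>s. F s x) has_vector_derivative F' t x) (at t)"
    and sF': "v \<in> eucl (Suc n) \<Longrightarrow>
      ((\<lambda>s. sdiff n (F s) x v) has_vector_derivative sdiff n (F' t) x v) (at t)"
    if "t \<in> {-\<delta><..<\<delta>}" "x \<in> ?S" for t x v
    using var that by simp_all
  have C1: "C1_family n {-\<delta><..<\<delta>} F" "C1_family n {-\<delta><..<\<delta>} F'"
    using var by simp_all
  have F0: "\<And>x. x \<in> ?S \<Longrightarrow> F 0 x = x"
    using F by (simp add: outer_variation_def)
  let ?e = "unit_vec"
  define q where "q t x = (\<Sum>i\<le>n. c * (sdiff n (F t) x (?e i) \<bullet> sdiff n (F t) x (?e i)))" for t x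
  define q' where "q' t x = (\<Sum>i\<le>n. c * (sdiff n (F t) x (?e i) \<bullet> sdiff n (F' t) x (?e i)
    + sdiff n (F' t) x (?e i) \<bullet> sdiff n (F t) x (?e i)))" for t x
  define f' where "f' t x = real m * (q' t x * q t x ^ (m - 1))" for t x
  have energy: "n_energy n (\<lambda>p v w. c * (v \<bullet> w)) (F t) = 1 / real n * (\<integral>x. q t x ^ m \<partial>sphere_measure n)" for t
  proof -
    have "q t x \<ge> 0" for x
      unfolding q_def using c by (intro sum_nonneg) auto
    then have "sqrt (q t x) ^ n = q t x ^ m" for x
      by (simp add: m power_mult)
    then show ?thesis
      by (simp add: n_energy_def sq_norm_diff_def q_def)
  qed
  have cont_sF: "continuous_on ({-\<delta><..<\<delta>} \<times> ?S) (\<lambda>(t, x). sdiff n (F t) x (?e i))"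
    "continuous_on ({-\<delta><..<\<delta>} \<times> ?S) (\<lambda>(t, x). sdiff n (F' t) x (?e i))" if "i \<le> n" for i
    using C1 that by (auto simp: C1_family_def)
  have cont_q: "continuous_on ({-\<delta><..<\<delta>} \<times> ?S) (\<lambda>(t, x). q t x)"
    unfolding q_def case_prod_beta
    by (intro continuous_intros cont_sF[unfolded case_prod_beta]) auto
  have cont_q': "continuous_on ({-\<delta><..<\<delta>} \<times> ?S) (\<lambda>(t, x). q' t x)"
    unfolding q'_def case_prod_beta
    by (intro continuous_intros cont_sF[unfolded case_prod_beta]) auto
  have cont_f': "continuous_on ({-\<delta><..<\<delta>} \<times> ?S) (\<lambda>(t, x). f' t x)"
    unfolding f'_def case_prod_beta
    by (intro continuous_intros cont_q[unfolded case_prod_beta] cont_q'[unfolded case_prod_beta])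
  have slice: "continuous_on ?S (g t)" if "continuous_on ({-\<delta><..<\<delta>} \<times> ?S) (\<lambda>(t, x). g t x)"
    "t \<in> {-\<delta><..<\<delta>}" for t and g :: "real \<Rightarrow> fseq \<Rightarrow> 'z::topological_space"
  proof -
    have "continuous_on ?S (\<lambda>x. (\<lambda>(t, x). g t x) (t, x))"
      by (rule continuous_on_compose2[OF that(1)],
          intro continuous_on_Pair continuous_on_const continuous_on_id) (use that(2) in auto)
    then show ?thesis
      by simp
  qed
  \<comment> \<open>Halving \<open>\<delta>\<close> gives a compact parameter interval, on which the
    continuous \<open>f'\<close> is bounded uniformly in \<open>t\<close> and
    \<open>x\<close>.\<close>
  have "compact ({-(\<delta>/2)..\<delta>/2} \<times> ?S)"
    by (intro compact_Times compact_Icc compact_rsphere)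
  moreover have "continuous_on ({-(\<delta>/2)..\<delta>/2} \<times> ?S) (\<lambda>(t, x). f' t x)"
    using \<delta> by (intro continuous_on_subset[OF cont_f']) auto
  ultimately have "bounded ((\<lambda>(t, x). f' t x) ` ({-(\<delta>/2)..\<delta>/2} \<times> ?S))"
    by (intro compact_imp_bounded compact_continuous_image)
  then obtain B where B: "\<And>t x. t \<in> {-(\<delta>/2)..\<delta>/2} \<Longrightarrow> x \<in> ?S \<Longrightarrow> \<bar>f' t x\<bar> \<le> B"
    by (force simp: bounded_iff)
  have "((\<lambda>t. \<integral>x. q t x ^ m \<partial>sphere_measure n) has_real_derivative (\<integral>x. f' 0 x \<partial>sphere_measure n)) (at 0)"
  proof (rule finite_measure.has_real_derivative_integral[OF finite_measure_sphere_measure])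
    fix t x assume t: "\<bar>t\<bar> < \<delta> / 2"
    then have t': "t \<in> {-\<delta><..<\<delta>}"
      using \<delta> by auto
    show "integrable (sphere_measure n) (\<lambda>x. q t x ^ m)"
      by (intro integrable_sphere_measure continuous_intros slice[OF cont_q t'])
    assume "x \<in> space (sphere_measure n)"
    then have x: "x \<in> ?S"
      by simp
    show "\<bar>f' t x\<bar> \<le> B"
      using t x by (intro B) auto
    have "((\<lambda>t. q t x) has_real_derivative q' t x) (at t)"
      unfolding q_def q'_def
    proof (intro DERIV_sum DERIV_cmult)
      fix i assume "i \<in> {..n}"
      then have "?e i \<in> eucl (Suc n)"
        by simp
      from bounded_bilinear.has_vector_derivative[OF bounded_bilinear_inner sF'[OF t' x this] sF'[OF t' x this]]
      show "((\<lambda>t. sdiff n (F t) x (?e i) \<bullet> sdiff n (F t) x (?e i)) has_real_derivative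
          sdiff n (F t) x (?e i) \<bullet> sdiff n (F' t) x (?e i) + sdiff n (F' t) x (?e i) \<bullet> sdiff n (F t) x (?e i)) (at t)"
        by (simp add: has_real_derivative_iff_has_vector_derivative)
    qed
    from DERIV_power[OF this, of m]
    show "((\<lambda>t. q t x ^ m) has_real_derivative f' t x) (at t)"
      by (simp add: f'_def)
  qed (use \<delta> in \<open>auto intro!: measurable_sphere_measure slice[OF cont_f']\<close>)
  moreover have "(\<integral>x. f' 0 x \<partial>sphere_measure n) = 0"
  proof -
    have 0: "0 \<in> {-\<delta><..<\<delta>}"
      using \<delta> by simp
    let ?V = "F' 0"
    have V: "?V differentiable (at x within ?S)" if "x \<in> ?S" for x
      using C1(2) that 0 by (auto simp: C1_family_def)
    have contV: "continuous_on ?S (\<lambda>x. sdiff n ?V x v)" if "v \<in> eucl (Suc n)" for v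
      using C1(2) that by (intro slice[OF _ 0, of "\<lambda>t x. sdiff n (F' t) x v"]) (auto simp: C1_family_def)
    \<comment> \<open>The curves \<open>F s x\<close> stay in the unit sphere, so
      \<open>F s x \<bullet> F s x = 1\<close> is differentiated at 0. The component of
      \<open>?V\<close> along \<open>unit_vec (Suc n)\<close> remains free, but the divergence sums
      only over the coordinates \<open>i \<le> n\<close>.\<close>
    have tangent: "x \<bullet> ?V x = 0" if x: "x \<in> ?S" for x
    proof -
      have "((\<lambda>s. F s x \<bullet> F s x) has_vector_derivative (F 0 x \<bullet> ?V x + ?V x \<bullet> F 0 x)) (at 0)"
        by (rule bounded_bilinear.has_vector_derivative[OF bounded_bilinear_inner F'[OF 0 x] F'[OF 0 x]])
      moreover have "((\<lambda>s. F s x \<bullet> F s x) has_vector_derivative 0) (at 0)"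
      proof (rule has_vector_derivative_transform_within_open)
        show "((\<lambda>s::real. 1::real) has_vector_derivative 0) (at 0)"
          by (rule has_vector_derivative_const)
        show "1 = F s x \<bullet> F s x" if "s \<in> {-\<delta><..<\<delta>}" for s
          using F_in[OF that x] by (simp add: rsphere_inner_self)
      qed (use 0 in auto)
      ultimately have "F 0 x \<bullet> ?V x + ?V x \<bullet> F 0 x = 0"
        by (rule vector_derivative_unique_at)
      then show ?thesis
        by (simp add: F0[OF x] inner_commute)
    qed
    have "f' 0 x = real m * (2 * c) * (c * real n) ^ (m - 1) * (\<Sum>i\<le>n. coord (sdiff n ?V x (?e i)) i)"
      if x: "x \<in> ?S" for x
    proof -
      have sF0: "sdiff n (F 0) x (?e i) = ?e i - coord x i *\<^sub>R x" if "i \<le> n" for i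
      proof -
        have "sdiff n (F 0) x (?e i) = sdiff n (\<lambda>x. x) x (?e i)"
          using sdiff_cong_fun[of n "F 0" "\<lambda>x. x" x] F0 x by simp
        then show ?thesis
          using that x by (simp add: sdiff_id inner_commute[of "?e i"] inner_unit_vec)
      qed
      have "(?e i - coord x i *\<^sub>R x) \<bullet> (?e i - coord x i *\<^sub>R x) = 1 - coord x i * coord x i" for i
        using rsphere_inner_self[OF x]
        by (simp add: inner_diff_left inner_diff_right inner_unit_vec inner_commute[of "?e i"])
      \<comment> \<open>The trace of the orthogonal projection to the tangent space:
        \<open>n + 1\<close> ones minus \<open>x \<bullet> x = 1\<close>.\<close>
      then have "q 0 x = (\<Sum>i\<le>n. c * (1 - coord x i * coord x i))"
        unfolding q_def by (intro sum.cong) (simp_all add: sF0)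
      also have "\<dots> = c * real n"
        using rsphere_coord_sum[OF x]
        by (simp add: sum_distrib_left[symmetric] sum_subtractf)
      finally have q0: "q 0 x = c * real n" .
      \<comment> \<open>The differential of the inclusion sends \<open>?e i\<close> to
        \<open>?e i - coord x i *\<^sub>R x\<close>; this shows that the second term contributes
        nothing to \<open>q'\<close>, so a pure divergence is left.\<close>
      have "(\<Sum>i\<le>n. coord x i *\<^sub>R sdiff n ?V x (?e i)) \<bullet> x = 0"
        by (simp add: sum_coord_sdiff[OF V[OF x] x])
      then have zero: "(\<Sum>i\<le>n. coord x i * (sdiff n ?V x (?e i) \<bullet> x)) = 0"
        by (simp add: inner_sum_left)
      have "q' 0 x = (\<Sum>i\<le>n. 2 * c * (sdiff n ?V x (?e i) \<bullet> (?e i - coord x i *\<^sub>R x)))"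
        unfolding q'_def by (intro sum.cong) (simp_all add: sF0 inner_commute)
      also have "\<dots> = 2 * c * ((\<Sum>i\<le>n. coord (sdiff n ?V x (?e i)) i) - (\<Sum>i\<le>n. coord x i * (sdiff n ?V x (?e i) \<bullet> x)))"
        by (simp add: sum_distrib_left[symmetric] sum_subtractf inner_diff_right inner_unit_vec)
      finally show ?thesis
        by (simp add: f'_def q0 zero)
    qed
    then have "(\<integral>x. f' 0 x \<partial>sphere_measure n) = (\<integral>x. real m * (2 * c) * (c * real n) ^ (m - 1) *
        (\<Sum>i\<le>n. coord (sdiff n ?V x (?e i)) i) \<partial>sphere_measure n)"
      by (intro Bochner_Integration.integral_cong) simp_all
    then show ?thesis
      using sphere_divergence[OF V contV tangent] by simp
  qed
  ultimately show "((\<lambda>t. n_energy n (\<lambda>p v w. c * (v \<bullet> w)) (F t)) has_real_derivative 0) (at 0)"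
    unfolding energy using DERIV_cmult[of "\<lambda>t. \<integral>x. q t x ^ m \<partial>sphere_measure n" 0 0 UNIV "1 / real n"] by simp
qed

section \<open>Regularity and null-homotopy of the equatorial inclusion\<close>

lemma C1_holder_on_sphere_id: "C1_holder_on_sphere n (1 / 2) (\<lambda>x. x)"
  unfolding C1_holder_on_sphere_def
\<comment> \<open>The differential \<open>v - (v \<bullet> x) *\<^sub>R x\<close> is Lipschitz in
  \<open>x\<close> with constant \<open>2 * norm v\<close>. Distances on the unit sphere are at most
  2, so a distance is at most \<open>sqrt 2\<close> times its square root.\<close>
proof (intro conjI ballI exI[of _ "2 * sqrt 2"])
  fix x y v assume x: "x \<in> rsphere n" and y: "y \<in> rsphere n" and v: "v \<in> eucl (Suc n)"
  have nx: "norm x = 1" and ny: "norm y = 1"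
    using x y by (simp_all add: rsphere_norm)
  have "sdiff n (\<lambda>x. x) x v - sdiff n (\<lambda>x. x) y v = (v \<bullet> (y - x)) *\<^sub>R y + (v \<bullet> x) *\<^sub>R (y - x)"
    using x y v by (simp add: sdiff_id algebra_simps inner_diff_right)
  then have "norm (sdiff n (\<lambda>x. x) x v - sdiff n (\<lambda>x. x) y v) \<le> \<bar>v \<bullet> (y - x)\<bar> + \<bar>v \<bullet> x\<bar> * norm (y - x)"
    using norm_triangle_ineq[of "(v \<bullet> (y - x)) *\<^sub>R y" "(v \<bullet> x) *\<^sub>R (y - x)"] ny by simp
  also have "\<dots> \<le> norm v * norm (y - x) + norm v * norm x * norm (y - x)"
    by (intro add_mono mult_right_mono Cauchy_Schwarz_ineq2) auto
  also have "\<dots> = 2 * norm v * dist x y"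
    by (simp add: nx dist_norm norm_minus_commute)
  also have "dist x y = sqrt (dist x y) * sqrt (dist x y)"
    by simp
  also have "2 * norm v * (sqrt (dist x y) * sqrt (dist x y)) \<le> 2 * norm v * (sqrt 2 * sqrt (dist x y))"
    using norm_triangle_ineq4[of x y] nx ny
    by (intro mult_left_mono mult_right_mono real_sqrt_le_mono) (auto simp: dist_norm)
  finally show "norm (sdiff n (\<lambda>x. x) x v - sdiff n (\<lambda>x. x) y v) \<le> 2 * sqrt 2 * dist x y powr (1 / 2) * norm v"
    by (simp add: powr_half_sqrt mult_ac)
qed simp

lemma equator_subset: "rsphere n \<subseteq> rsphere (Suc n)"
  using eucl_mono[of "Suc n" "Suc (Suc n)"] by (auto simp: rsphere_iff)

lemma null_homotopic_equator: "null_homotopic n (rsphere (Suc n)) (\<lambda>x. x)"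
  unfolding null_homotopic_def homotopic_with_def
proof (intro exI conjI allI ballI)
  let ?e = "unit_vec (Suc n)"
  \<comment> \<open>The new coordinate vector is orthogonal to the whole equator, so each point
    moves on a meridian and all meet at the pole after a quarter turn.\<close>
  let ?H = "\<lambda>(t, x). great_circle x ?e (t * (pi / 2))"
  have "?H p \<in> rsphere (Suc n)" if p01: "p \<in> {0..1} \<times> rsphere n" for p
  proof -
    obtain t x where p: "p = (t, x)" and x: "x \<in> rsphere n"
      using p01 by auto
    have "x \<bullet> ?e = 0"
      using x by (simp add: inner_unit_vec rsphere_iff eucl_def)
    then show ?thesis
      using x equator_subset[of n] unfolding p prod.case
      by (intro great_circle_in_rsphere unit_vec_in_rsphere) auto
  qed
  moreover have "continuous_on ({0..1} \<times> rsphere n) ?H"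
    unfolding great_circle_def case_prod_beta by (intro continuous_intros)
  ultimately show "continuous_map (prod_topology (top_of_set {0..1}) (top_of_set (rsphere n)))
      (top_of_set (rsphere (Suc n))) ?H"
    by (auto simp: continuous_map_in_subtopology prod_topology_subtopology subtopology_subtopology
        continuous_map_iff_continuous euclidean_product_topology Times_Int_Times)
qed (simp_all add: great_circle_def)

theorem theorem1p2:
  shows "\<exists>P :: (nat \<times> (fseq set \<times> metric_tensor)) set.
    infinite (fst ` P) \<and>
    (\<exists>T \<subseteq> snd ` P. infinite T \<and> pairwise (\<lambda>N N'. \<not> isometric N N') T) \<and>
    (\<forall>(n, N) \<in> P. n \<ge> 2 \<and> closed_riemannian N \<and>
      (\<exists>u. u ` rsphere n \<subseteq> fst N \<and>
        (\<exists>\<alpha>. 0 < \<alpha> \<and> \<alpha> < 1 \<and> C1_holder_on_sphere n \<alpha> u) \<and>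
        \<not> u constant_on rsphere n \<and>
        null_homotopic n (fst N) u \<and>
        n_harmonic n N u))"
proof -
  \<comment> \<open>The dimensions run through the even numbers from 2 on. The target is one
    dimension larger, and the scale \<open>4 ^ k\<close> makes any two different targets differ in
    scale by a factor of at least 4.\<close>
  define dm where "dm k = 2 * k + 2" for k :: nat
  define N :: "nat \<Rightarrow> fseq set \<times> metric_tensor"
    where "N k = (rsphere (Suc (dm k)), \<lambda>p v w. 4 ^ k * (v \<bullet> w))" for k
  define P where "P = range (\<lambda>k. (dm k, N k))"
  have "4 * (4::real) ^ k \<le> 4 ^ l" if "k < l" for k l
    using power_increasing[of "Suc k" l "4 :: real"] that by simp
  then have not_iso: "\<not> isometric (N k) (N l)" if "k \<noteq> l" for k l
    unfolding N_def using that by (intro not_isometric_rspheres) (auto simp: neq_iff)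
  have "inj dm"
    by (auto simp: dm_def inj_def)
  then have inf_fst: "infinite (fst ` P)"
    by (simp add: P_def image_image range_inj_infinite)
  have "inj N"
  proof (rule injI)
    fix k l assume "N k = N l"
    \<comment> \<open>Evaluating the metric on a unit vector reads off the scale
      \<open>4 ^ k\<close>, which determines \<open>k\<close>.\<close>
    then have "snd (N k) 0 (unit_vec 0) (unit_vec 0) = snd (N l) 0 (unit_vec 0) (unit_vec 0)"
      by simp
    then show "k = l"
      by (simp add: N_def inner_unit_vec)
  qed
  then have inf_snd: "infinite (snd ` P)"
    by (simp add: P_def image_image range_inj_infinite)
  have pairwise: "pairwise (\<lambda>N N'. \<not> isometric N N') (snd ` P)"
  proof (rule pairwiseI)
    fix X Y assume XY: "X \<in> snd ` P" "Y \<in> snd ` P" "X \<noteq> Y"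
    then obtain k l where kl: "X = N k" "Y = N l"
      by (auto simp: P_def)
    with XY(3) have "k \<noteq> l"
      by auto
    then show "\<not> isometric X Y"
      unfolding kl by (rule not_iso)
  qed
  have nonconstant: "\<not> (\<lambda>x. x) constant_on rsphere n" for n
  proof
    assume "(\<lambda>x. x) constant_on rsphere n"
    then obtain y where y: "\<And>x. x \<in> rsphere n \<Longrightarrow> x = y"
      unfolding constant_on_def by blast
    have e: "unit_vec 0 \<in> rsphere n"
      by (rule unit_vec_in_rsphere) simp
    then have "- unit_vec 0 \<in> rsphere n"
      using subspace_neg[OF subspace_eucl]
      by (simp only: rsphere_iff inner_minus_left inner_minus_right minus_minus)
    from y[OF this] y[OF e] have "coord (- unit_vec 0) 0 = coord (unit_vec 0) 0"
      by simp
    then show False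
      by simp
  qed
  have harmonic: "n_harmonic (dm k) (N k) (\<lambda>x. x)" for k
    unfolding N_def by (rule n_harmonic_equator) (simp_all add: dm_def)
  have closed_N: "closed_riemannian (N k)" for k
    unfolding N_def by (rule closed_riemannian_rsphere) simp_all
  have holder: "\<exists>\<alpha>. 0 < \<alpha> \<and> \<alpha> < 1 \<and> C1_holder_on_sphere n \<alpha> (\<lambda>x. x)" for n
    using C1_holder_on_sphere_id by (intro exI[of _ "1 / 2"]) simp
  show ?thesis
  proof (intro exI[of _ P] conjI exI[of _ "snd ` P"] subset_refl inf_fst inf_snd pairwise ballI)
    fix X assume "X \<in> P"
    then obtain k where X: "X = (dm k, N k)"
      by (auto simp: P_def)
    have fst_N: "fst (N k) = rsphere (Suc (dm k))"
      by (simp add: N_def)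
    have "(\<lambda>x. x) ` rsphere (dm k) \<subseteq> fst (N k) \<and>
        (\<exists>\<alpha>. 0 < \<alpha> \<and> \<alpha> < 1 \<and> C1_holder_on_sphere (dm k) \<alpha> (\<lambda>x. x)) \<and>
        \<not> (\<lambda>x. x) constant_on rsphere (dm k) \<and>
        null_homotopic (dm k) (fst (N k)) (\<lambda>x. x) \<and> n_harmonic (dm k) (N k) (\<lambda>x. x)"
      using equator_subset holder nonconstant null_homotopic_equator harmonic
      by (simp add: fst_N)
    moreover have "dm k \<ge> 2"
      by (simp add: dm_def)
    ultimately show "case X of (n, N) \<Rightarrow> n \<ge> 2 \<and> closed_riemannian N \<and>
      (\<exists>u. u ` rsphere n \<subseteq> fst N \<and>
        (\<exists>\<alpha>. 0 < \<alpha> \<and> \<alpha> < 1 \<and> C1_holder_on_sphere n \<alpha> u) \<and>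
        \<not> u constant_on rsphere n \<and>
        null_homotopic n (fst N) u \<and>
        n_harmonic n N u)"
      unfolding X prod.case using closed_N by blast
  qed
qed

end
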